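(* A simplicial set $X$ is a quasi-2-Segal set if and only if its edgewise subdivision $\mathrm{esd}\,X$ is a quasi-category.
   Context: $\Delta[n]$ is the standard $n$-simplex and $d_\ell\Delta[n]$ is its face opposite the vertex $\ell$. For $n\geq 3$, a subset $S\subseteq\{0,\ldots,n\}$ is broken if there exist $0\leq i<j<k<\ell\leq n$ such that either $i,k\in S$ and $j,\ell\notin S$, or $i,k\notin S$ and $j,\ell\in S$. For $n\ge 3$ and a broken two-element subset $\{i,j\}\subseteq\{0,\ldots,n\}$, the 2-Segal horn $\Lambda^{i,j}[n]\subseteq\Delta[n]$ is the union of all faces $d_\ell\Delta[n]$ with $\ell\neq i,j$. A simplicial set $X$ is a quasi-2-Segal set if every map $\Lambda^{i,j}[n]\to X$ from a 2-Segal horn extends along the inclusion $\Lambda^{i,j}[n]\hookrightarrow\Delta[n]$ to a map $\Delta[n]\to X$. Let $\varepsilon\colon\Delta\to\Delta$ be the functor sending $[n]$ to the join $[n]^{\mathrm{op}}\star[n]\cong[2n+1]$. The edgewise subdivision of a simplicial set $X\colon\Delta^{\mathrm{op}}\to\mathsf{Set}$ is $\mathrm{esd}\,X=X\circ\varepsilon$ (i.e. $X$ precomposed with $\varepsilon^{\mathrm{op}}$), so $(\mathrm{esd}\,X)_n=X_{2n+1}$. A quasi-category is a simplicial set with fillers of all inner horn inclusions $\Lambda^i[n]\hookrightarrow\Delta[n]$, $0<i<n$. *)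

theory Defs
  imports Main "HOL-Library.FuncSet"
begin

text \<open>
  The simplex category: \<open>[n]\<close> is \<open>{..n}\<close>, and a morphism \<open>[m] \<rightarrow> [n]\<close> is a monotone function,
  normalised to be \<open>undefined\<close> outside \<open>{..m}\<close> so that equality of morphisms is equality in HOL.
\<close>

definition ord_maps :: "nat \<Rightarrow> nat \<Rightarrow> (nat \<Rightarrow> nat) set" where
  "ord_maps m n = {\<theta> \<in> {..m} \<rightarrow>\<^sub>E {..n}. mono_on {..m} \<theta>}"

definition ord_id :: "nat \<Rightarrow> nat \<Rightarrow> nat" where
  "ord_id n = (\<lambda>i\<in>{..n}. i)"

text \<open>For \<open>\<theta> : [m] \<rightarrow> [n]\<close>, the action \<open>act X m n \<theta>\<close> goes from \<open>X\<^sub>n\<close> to \<open>X\<^sub>m\<close>.\<close>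

record 'a sset =
  simplices :: "nat \<Rightarrow> 'a set"
  act :: "nat \<Rightarrow> nat \<Rightarrow> (nat \<Rightarrow> nat) \<Rightarrow> 'a \<Rightarrow> 'a"

locale simplicial_set =
  fixes X :: "'a sset"
  assumes act_closed:
      "\<theta> \<in> ord_maps m n \<Longrightarrow> x \<in> simplices X n \<Longrightarrow> act X m n \<theta> x \<in> simplices X m"
    and act_id: "x \<in> simplices X n \<Longrightarrow> act X n n (ord_id n) x = x"
    and act_comp:
      "\<theta> \<in> ord_maps l m \<Longrightarrow> \<phi> \<in> ord_maps m n \<Longrightarrow> x \<in> simplices X n \<Longrightarrow>
        act X l n (compose {..l} \<phi> \<theta>) x = act X l m \<theta> (act X m n \<phi> x)"

text \<open>Values of \<open>f m\<close> outside \<open>simplices A m\<close> carry no meaning.\<close>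

definition simplicial_map :: "'a sset \<Rightarrow> 'b sset \<Rightarrow> (nat \<Rightarrow> 'a \<Rightarrow> 'b) \<Rightarrow> bool" where
  "simplicial_map A B f \<longleftrightarrow>
    (\<forall>n. \<forall>x\<in>simplices A n. f n x \<in> simplices B n) \<and>
    (\<forall>m n. \<forall>\<theta>\<in>ord_maps m n. \<forall>x\<in>simplices A n. f m (act A m n \<theta> x) = act B m n \<theta> (f n x))"

definition std_simplex :: "nat \<Rightarrow> (nat \<Rightarrow> nat) sset" where
  "std_simplex n = \<lparr>simplices = (\<lambda>m. ord_maps m n), act = (\<lambda>l m \<theta> \<sigma>. compose {..l} \<sigma> \<theta>)\<rparr>"

text \<open>The face opposite the vertex \<open>l\<close> consists of the simplices that do not have \<open>l\<close> as a vertex.\<close>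

definition face_simplices :: "nat \<Rightarrow> nat \<Rightarrow> nat \<Rightarrow> (nat \<Rightarrow> nat) set" where
  "face_simplices n l m = {\<sigma> \<in> simplices (std_simplex n) m. l \<notin> \<sigma> ` {..m}}"

definition face_union :: "nat \<Rightarrow> nat set \<Rightarrow> (nat \<Rightarrow> nat) sset" where
  "face_union n L =
    \<lparr>simplices = (\<lambda>m. \<Union>l\<in>L. face_simplices n l m), act = act (std_simplex n)\<rparr>"

definition horn :: "nat \<Rightarrow> nat \<Rightarrow> (nat \<Rightarrow> nat) sset" where
  "horn n i = face_union n ({..n} - {i})"

definition two_segal_horn :: "nat \<Rightarrow> nat \<Rightarrow> nat \<Rightarrow> (nat \<Rightarrow> nat) sset" where
  "two_segal_horn n i j = face_union n ({..n} - {i, j})"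

definition broken :: "nat \<Rightarrow> nat set \<Rightarrow> bool" where
  "broken n S \<longleftrightarrow> S \<subseteq> {..n} \<and>
    (\<exists>i j k l. i < j \<and> j < k \<and> k < l \<and> l \<le> n \<and>
      (i \<in> S \<and> k \<in> S \<and> j \<notin> S \<and> l \<notin> S \<or> i \<notin> S \<and> k \<notin> S \<and> j \<in> S \<and> l \<in> S))"

definition has_extensions :: "'a sset \<Rightarrow> (nat \<Rightarrow> nat) sset \<Rightarrow> nat \<Rightarrow> bool" where
  "has_extensions X A n \<longleftrightarrow>
    (\<forall>f. simplicial_map A X f \<longrightarrow>
      (\<exists>g. simplicial_map (std_simplex n) X g \<and> (\<forall>m. \<forall>\<sigma>\<in>simplices A m. g m \<sigma> = f m \<sigma>)))"

definition quasi_2_segal_set :: "'a sset \<Rightarrow> bool" where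
  "quasi_2_segal_set X \<longleftrightarrow> simplicial_set X \<and>
    (\<forall>n\<ge>3. \<forall>i j. i \<noteq> j \<and> broken n {i, j} \<longrightarrow> has_extensions X (two_segal_horn n i j) n)"

definition quasi_category :: "'a sset \<Rightarrow> bool" where
  "quasi_category X \<longleftrightarrow> simplicial_set X \<and>
    (\<forall>n i. 0 < i \<and> i < n \<longrightarrow> has_extensions X (horn n i) n)"

text \<open>
  The functor \<open>[n] \<mapsto> [n]\<^sup>o\<^sup>p \<star> [n]\<close> on morphisms. The join is identified with \<open>[2n+1]\<close> by sending
  \<open>i\<close> in \<open>[n]\<^sup>o\<^sup>p\<close> to \<open>n - i\<close> and \<open>i\<close> in \<open>[n]\<close> to \<open>n + 1 + i\<close>, so that \<open>\<theta>\<^sup>o\<^sup>p \<star> \<theta>\<close> becomes the map below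
  (see \<open>eps_map_op\<close> and \<open>eps_map_id\<close>).
\<close>

definition eps_map :: "nat \<Rightarrow> nat \<Rightarrow> (nat \<Rightarrow> nat) \<Rightarrow> nat \<Rightarrow> nat" where
  "eps_map m n \<theta> = (\<lambda>k\<in>{..2*m+1}. if k \<le> m then n - \<theta> (m - k) else n + 1 + \<theta> (k - (m + 1)))"

definition esd :: "'a sset \<Rightarrow> 'a sset" where
  "esd X = \<lparr>simplices = (\<lambda>n. simplices X (2*n+1)),
            act = (\<lambda>m n \<theta>. act X (2*m+1) (2*n+1) (eps_map m n \<theta>))\<rparr>"

lemma eps_map_op: "i \<le> m \<Longrightarrow> eps_map m n \<theta> (m - i) = n - \<theta> i"
  by (auto simp: eps_map_def)

lemma eps_map_id: "i \<le> m \<Longrightarrow> eps_map m n \<theta> (m + 1 + i) = n + 1 + \<theta> i"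
  by (simp add: eps_map_def)

lemma ord_maps_le: "\<theta> \<in> ord_maps m n \<Longrightarrow> i \<le> m \<Longrightarrow> \<theta> i \<le> n"
  by (auto simp: ord_maps_def PiE_def Pi_def)

lemma ord_maps_mono: "\<theta> \<in> ord_maps m n \<Longrightarrow> i \<le> j \<Longrightarrow> j \<le> m \<Longrightarrow> \<theta> i \<le> \<theta> j"
  by (auto simp: ord_maps_def monotone_on_def)

lemma ord_maps_undefined: "\<theta> \<in> ord_maps m n \<Longrightarrow> \<not> i \<le> m \<Longrightarrow> \<theta> i = undefined"
  by (auto simp: ord_maps_def PiE_def extensional_def)

lemma ord_mapsI:
  assumes "\<And>i. i \<le> m \<Longrightarrow> \<theta> i \<le> n" "\<And>i j. i \<le> j \<Longrightarrow> j \<le> m \<Longrightarrow> \<theta> i \<le> \<theta> j"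
    and "\<And>i. \<not> i \<le> m \<Longrightarrow> \<theta> i = undefined"
  shows "\<theta> \<in> ord_maps m n"
  using assms by (auto simp: ord_maps_def PiE_def Pi_def extensional_def monotone_on_def)

lemma ord_maps_compose:
  "\<theta> \<in> ord_maps l m \<Longrightarrow> \<phi> \<in> ord_maps m n \<Longrightarrow> compose {..l} \<phi> \<theta> \<in> ord_maps l n"
  by (rule ord_mapsI) (auto simp: compose_def intro: ord_maps_le ord_maps_mono)

lemma eps_map_in_ord_maps:
  assumes "\<theta> \<in> ord_maps m n"
  shows "eps_map m n \<theta> \<in> ord_maps (2*m+1) (2*n+1)"
proof (rule ord_mapsI)
  fix i assume "i \<le> 2*m+1"
  then show "eps_map m n \<theta> i \<le> 2*n+1"
    using ord_maps_le[OF assms, of "i - (m + 1)"] by (auto simp: eps_map_def)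
next
  fix i j assume ij: "i \<le> j" "j \<le> 2*m+1"
  consider "j \<le> m" | "i \<le> m" "m < j" | "m < i" by linarith
  then show "eps_map m n \<theta> i \<le> eps_map m n \<theta> j"
  proof cases
    case 1
    then show ?thesis using ij ord_maps_mono[OF assms, of "m - j" "m - i"]
      by (auto simp: eps_map_def intro!: diff_le_mono2 ord_maps_mono[OF assms])
  next
    case 2
    then show ?thesis using ij by (auto simp: eps_map_def)
  next
    case 3
    then show ?thesis using ij ord_maps_mono[OF assms, of "i - (m+1)" "j - (m+1)"]
      by (auto simp: eps_map_def)
  qed
qed (auto simp: eps_map_def)

lemma eps_map_ord_id: "eps_map n n (ord_id n) = ord_id (2*n+1)"
  by (auto simp: eps_map_def ord_id_def restrict_def fun_eq_iff)

lemma eps_map_compose: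
  assumes "\<theta> \<in> ord_maps l m" "\<phi> \<in> ord_maps m n"
  shows "eps_map l n (compose {..l} \<phi> \<theta>) = compose {..2*l+1} (eps_map m n \<phi>) (eps_map l m \<theta>)"
proof
  fix k
  consider "k \<le> l" | "l < k" "k \<le> 2*l+1" | "2*l+1 < k" by linarith
  then show "eps_map l n (compose {..l} \<phi> \<theta>) k
      = compose {..2*l+1} (eps_map m n \<phi>) (eps_map l m \<theta>) k"
  proof cases
    case 1
    then show ?thesis using ord_maps_le[OF assms(1), of "l - k"]
      by (auto simp: eps_map_def compose_def)
  next
    case 2
    then show ?thesis using ord_maps_le[OF assms(1), of "k - (l + 1)"]
      by (auto simp: eps_map_def compose_def)
  qed (auto simp: eps_map_def compose_def)
qed

lemma simplicial_set_std_simplex: "simplicial_set (std_simplex n)"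
proof
  fix x m assume "x \<in> simplices (std_simplex n) m"
  then show "act (std_simplex n) m m (ord_id m) x = x"
    using ord_maps_undefined[of x m n]
    by (auto simp: std_simplex_def ord_id_def compose_def restrict_def fun_eq_iff)
next
  fix \<theta> \<phi> x k l m
  assume "\<theta> \<in> ord_maps k l" "\<phi> \<in> ord_maps l m" "x \<in> simplices (std_simplex n) m"
  then show "act (std_simplex n) k m (compose {..k} \<phi> \<theta>) x
      = act (std_simplex n) k l \<theta> (act (std_simplex n) l m \<phi> x)"
    using ord_maps_le[of \<theta> k l]
    by (auto simp: std_simplex_def compose_def restrict_def fun_eq_iff)
qed (auto simp: std_simplex_def intro: ord_maps_compose)

lemma simplicial_set_face_union: "simplicial_set (face_union n L)"
proof -
  interpret S: simplicial_set "std_simplex n" by (rule simplicial_set_std_simplex)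
  show ?thesis
  proof
    fix \<theta> m k x assume th: "\<theta> \<in> ord_maps m k" and x: "x \<in> simplices (face_union n L) k"
    from x obtain l where l: "l \<in> L" "x \<in> simplices (std_simplex n) k" "l \<notin> x ` {..k}"
      by (auto simp: face_union_def face_simplices_def)
    have "l \<notin> act (std_simplex n) m k \<theta> x ` {..m}"
      using l(3) ord_maps_le[OF th] by (auto simp: std_simplex_def compose_def)
    with l th show "act (face_union n L) m k \<theta> x \<in> simplices (face_union n L) m"
      by (auto simp: face_union_def face_simplices_def intro: S.act_closed)
  qed (auto simp: face_union_def face_simplices_def S.act_id S.act_comp)
qed

lemma simplicial_set_esd:
  assumes "simplicial_set X"
  shows "simplicial_set (esd X)"
proof -
  interpret simplicial_set X by fact
  show ?thesis
  proof
    fix \<theta> m n x assume "\<theta> \<in> ord_maps m n" "x \<in> simplices (esd X) n"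
    then show "act (esd X) m n \<theta> x \<in> simplices (esd X) m"
      using act_closed[OF eps_map_in_ord_maps] by (simp add: esd_def)
  next
    fix x n assume "x \<in> simplices (esd X) n"
    then show "act (esd X) n n (ord_id n) x = x"
      using act_id[of x "2*n+1"] eps_map_ord_id[of n] by (simp add: esd_def)
  next
    fix \<theta> \<phi> x l m n
    assume "\<theta> \<in> ord_maps l m" "\<phi> \<in> ord_maps m n" "x \<in> simplices (esd X) n"
    then show "act (esd X) l n (compose {..l} \<phi> \<theta>) x = act (esd X) l m \<theta> (act (esd X) m n \<phi> x)"
      using act_comp[OF eps_map_in_ord_maps eps_map_in_ord_maps] eps_map_compose[of \<theta> l m \<phi> n]
      by (simp add: esd_def)
  qed
qed

end

theory Submission
  imports Defs "HOL-Library.Infinite_Set"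
begin

text \<open>
  By adjunction, an inner horn in \<open>esd X\<close> is a map to \<open>X\<close> from the subcomplex of the
  \<open>(2m+1)\<close>-simplex spanned by the faces that omit some pair \<open>{m - k, m + 1 + k}\<close> with \<open>k \<noteq> i\<close>.
  The simplices missing from it are adjoined along 2-Segal horns at the remaining pair
  \<open>{m - i, m + 1 + i}\<close>.

  Conversely, the 2-Segal horns at \<open>{0, j}\<close> and \<open>{i, n}\<close> are retracts of such subcomplexes. The
  other 2-Segal horns are reduced to these by induction on \<open>i\<close>: the horn at \<open>{i, j}\<close> has a filler
  that is correct except on the face opposite \<open>0\<close>, and filling the horn at \<open>{i - 1, j - 1}\<close> gives
  a homotopy along which this face can be corrected.
\<close>

section \<open>Monotone maps and simplicial subsets of a simplex\<close>

lemma compose_assoc_ord: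
  "\<phi> \<in> ord_maps l m \<Longrightarrow>
    compose {..l} (compose {..m} \<theta> \<sigma>) \<phi> = compose {..l} \<theta> (compose {..l} \<sigma> \<phi>)"
  using ord_maps_le[of \<phi> l m] by (auto simp: compose_def restrict_def fun_eq_iff)

lemma image_compose: "compose A g f ` A = g ` f ` A"
  by (auto simp: compose_def image_image)

lemma image_ord_maps: "\<sigma> \<in> ord_maps m n \<Longrightarrow> \<sigma> ` {..m} \<subseteq> {..n}"
  using ord_maps_le by fastforce

lemma compose_eq_self:
  assumes "\<sigma> \<in> ord_maps m n" "\<And>x. x \<in> \<sigma> ` {..m} \<Longrightarrow> \<theta> x = x"
  shows "compose {..m} \<theta> \<sigma> = \<sigma>"
  using assms ord_maps_undefined[OF assms(1)] by (auto simp: compose_def restrict_def fun_eq_iff)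

definition down_closed :: "nat set set \<Rightarrow> bool" where
  "down_closed K \<longleftrightarrow> (\<forall>S\<in>K. \<forall>T. T \<subseteq> S \<longrightarrow> T \<in> K)"

lemma down_closedD: "down_closed K \<Longrightarrow> S \<in> K \<Longrightarrow> T \<subseteq> S \<Longrightarrow> T \<in> K"
  unfolding down_closed_def by blast

text \<open>A simplicial subset of a simplex contains a simplex exactly when it contains the
  nondegenerate simplex on the same vertices, so a family of vertex sets describes it.
  \<open>down_closed\<close> makes such a family stable under faces.\<close>

definition subcomplex :: "nat \<Rightarrow> nat set set \<Rightarrow> (nat \<Rightarrow> nat) sset" where
  "subcomplex N K =
    \<lparr>simplices = (\<lambda>m. {\<sigma> \<in> ord_maps m N. \<sigma> ` {..m} \<in> K}), act = act (std_simplex N)\<rparr>"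

lemma subcomplex_simplices [simp]:
  "simplices (subcomplex N K) m = {\<sigma> \<in> ord_maps m N. \<sigma> ` {..m} \<in> K}"
  by (simp add: subcomplex_def)

lemma subcomplex_act [simp]: "act (subcomplex N K) l m \<theta> \<sigma> = compose {..l} \<sigma> \<theta>"
  by (simp add: subcomplex_def std_simplex_def)

lemma subcomplex_eq:
  assumes "\<And>S. S \<subseteq> {..N} \<Longrightarrow> S \<in> K \<longleftrightarrow> S \<in> K'"
  shows "subcomplex N K = subcomplex N K'"
  unfolding subcomplex_def using assms image_ord_maps by fastforce

lemma std_simplex_eq_subcomplex: "std_simplex N = subcomplex N UNIV"
  by (simp add: subcomplex_def std_simplex_def)

lemma face_union_eq_subcomplex: "face_union N L = subcomplex N {S. \<not> L \<subseteq> S}"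
  by (auto simp: subcomplex_def face_union_def face_simplices_def std_simplex_def fun_eq_iff)

lemma simplicial_map_pullback:
  assumes f: "simplicial_map (subcomplex N B) X f" and th: "\<theta> \<in> ord_maps M N"
    and sub: "\<And>S. S \<subseteq> {..M} \<Longrightarrow> S \<in> A \<Longrightarrow> \<theta> ` S \<in> B"
  shows "simplicial_map (subcomplex M A) X (\<lambda>m \<sigma>. f m (compose {..m} \<theta> \<sigma>))"
proof -
  have *: "compose {..m} \<theta> \<sigma> \<in> simplices (subcomplex N B) m"
    if "\<sigma> \<in> simplices (subcomplex M A) m" for m \<sigma>
    using that ord_maps_compose[OF _ th] sub image_ord_maps[of \<sigma> m M] by (auto simp: image_compose)
  have **: "f l (compose {..l} \<theta> (compose {..l} \<sigma> \<phi>)) = act X l m \<phi> (f m (compose {..m} \<theta> \<sigma>))"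
    if "\<phi> \<in> ord_maps l m" "\<sigma> \<in> simplices (subcomplex M A) m" for l m \<phi> \<sigma>
    using f that(1) *[OF that(2)] compose_assoc_ord[OF that(1), of \<theta> \<sigma>]
    unfolding simplicial_map_def by (metis subcomplex_act)
  show ?thesis
    unfolding simplicial_map_def using f[unfolded simplicial_map_def] * ** by (auto simp del: subcomplex_simplices)
qed

lemma simplicial_map_restrict:
  assumes "simplicial_map (subcomplex N B) X f" "\<And>S. S \<subseteq> {..N} \<Longrightarrow> S \<in> A \<Longrightarrow> S \<in> B"
  shows "simplicial_map (subcomplex N A) X f"
  using assms image_ord_maps unfolding simplicial_map_def by fastforce

text \<open>Faces of a simplex in \<open>A\<close> stay in \<open>A\<close>, and likewise for
  \<open>B\<close>. Naturality can thus be checked on each piece, and agreement on the overlap makes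
  the choice between \<open>f\<close> and \<open>g\<close> immaterial.\<close>

lemma simplicial_map_glue:
  assumes f: "simplicial_map (subcomplex N A) X f" and g: "simplicial_map (subcomplex N B) X g"
    and "down_closed A" "down_closed B"
    and eq: "\<And>m \<sigma>. \<sigma> \<in> ord_maps m N \<Longrightarrow> \<sigma> ` {..m} \<in> A \<Longrightarrow> \<sigma> ` {..m} \<in> B \<Longrightarrow> f m \<sigma> = g m \<sigma>"
  obtains h where "simplicial_map (subcomplex N (A \<union> B)) X h"
    "\<And>m \<sigma>. \<sigma> \<in> ord_maps m N \<Longrightarrow> \<sigma> ` {..m} \<in> A \<Longrightarrow> h m \<sigma> = f m \<sigma>"
    "\<And>m \<sigma>. \<sigma> \<in> ord_maps m N \<Longrightarrow> \<sigma> ` {..m} \<in> B \<Longrightarrow> h m \<sigma> = g m \<sigma>"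
proof
  define h where "h m \<sigma> = (if \<sigma> ` {..m} \<in> A then f m \<sigma> else g m \<sigma>)" for m \<sigma>
  show hA: "h m \<sigma> = f m \<sigma>" if "\<sigma> \<in> ord_maps m N" "\<sigma> ` {..m} \<in> A" for m \<sigma>
    using that by (simp add: h_def)
  show hB: "h m \<sigma> = g m \<sigma>" if "\<sigma> \<in> ord_maps m N" "\<sigma> ` {..m} \<in> B" for m \<sigma>
    using that eq by (simp add: h_def)
  show "simplicial_map (subcomplex N (A \<union> B)) X h"
    unfolding simplicial_map_def
  proof (intro conjI allI ballI)
    fix n x assume "x \<in> simplices (subcomplex N (A \<union> B)) n"
    then show "h n x \<in> simplices X n"
      using f g hA hB by (auto simp: simplicial_map_def)
  next
    fix m n \<theta> x assume th: "\<theta> \<in> ord_maps m n" and x: "x \<in> simplices (subcomplex N (A \<union> B)) n"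
    have c: "compose {..m} x \<theta> \<in> ord_maps m N" using ord_maps_compose[OF th] x by auto
    have i: "compose {..m} x \<theta> ` {..m} \<subseteq> x ` {..n}"
      using image_ord_maps[OF th] by (auto simp: image_compose)
    from x consider "x \<in> ord_maps n N" "x ` {..n} \<in> A" | "x \<in> ord_maps n N" "x ` {..n} \<in> B" by auto
    then show "h m (act (subcomplex N (A \<union> B)) m n \<theta> x) = act X m n \<theta> (h n x)"
    proof cases
      case 1
      then have "h m (compose {..m} x \<theta>) = f m (compose {..m} x \<theta>)"
        using hA c i assms(3) down_closedD by blast
      with 1 f th hA show ?thesis by (simp add: simplicial_map_def)
    next
      case 2
      then have "h m (compose {..m} x \<theta>) = g m (compose {..m} x \<theta>)"
        using hB c i assms(4) down_closedD by blast
      with 2 g th hB show ?thesis by (simp add: simplicial_map_def)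
    qed
  qed
qed

section \<open>Injective monotone maps and the attachment of simplices\<close>

lemma ord_maps_retraction:
  assumes th: "\<theta> \<in> ord_maps n N" and inj: "inj_on \<theta> {..n}"
  obtains \<rho> where "\<rho> \<in> ord_maps N n" "\<And>k. k \<le> n \<Longrightarrow> \<rho> (\<theta> k) = k"
proof
  \<comment> \<open>This sends \<open>x\<close> to the largest \<open>i\<close> with
    \<open>\<theta> i \<le> x\<close>, or to \<open>0\<close> if there is none; counting from
    \<open>1\<close> yields the index itself and not its successor.\<close>
  define \<rho> where "\<rho> = (\<lambda>x\<in>{..N}. card {i \<in> {1..n}. \<theta> i \<le> x})"
  show "\<rho> \<in> ord_maps N n"
  proof (rule ord_mapsI)
    fix i assume "i \<le> N"
    have "card {k \<in> {1..n}. \<theta> k \<le> i} \<le> card {1..n}" by (rule card_mono) auto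
    then show "\<rho> i \<le> n" using \<open>i \<le> N\<close> by (simp add: \<rho>_def)
  next
    fix i j assume "i \<le> j" "j \<le> N"
    then show "\<rho> i \<le> \<rho> j" by (auto simp: \<rho>_def intro!: card_mono)
  qed (simp add: \<rho>_def)
  fix k assume k: "k \<le> n"
  have "\<theta> i \<le> \<theta> k \<longleftrightarrow> i \<le> k" if "i \<le> n" for i
    using ord_maps_mono[OF th, of i k] ord_maps_mono[OF th, of k i] inj k that
    by (metis atMost_iff inj_on_def le_antisym nat_le_linear)
  then have "{i \<in> {1..n}. \<theta> i \<le> \<theta> k} = {1..k}" using k by auto
  then show "\<rho> (\<theta> k) = k" using k ord_maps_le[OF th k] by (simp add: \<rho>_def)
qed

lemma ord_maps_enumeration:
  assumes "U \<subseteq> {..N}" "U \<noteq> {}"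
  obtains n \<theta> where "\<theta> \<in> ord_maps n N" "inj_on \<theta> {..n}" "\<theta> ` {..n} = U"
proof -
  have fin: "finite U" using assms finite_subset by blast
  obtain h where h: "bij_betw h {..<card U} U" "strict_mono_on {..<card U} h"
    using ex_bij_betw_strict_mono_card[OF fin] by blast
  have pos: "card U > 0" using fin assms by (simp add: card_gt_0_iff)
  define n where "n = card U - 1"
  have s: "{..<card U} = {..n}" using pos by (auto simp: n_def)
  define \<theta> where "\<theta> = restrict h {..n}"
  have "\<theta> ` {..n} = U" "inj_on \<theta> {..n}"
    using h(1) by (auto simp: s \<theta>_def bij_betw_def inj_on_def)
  moreover have "\<theta> \<in> ord_maps n N"
  proof (rule ord_mapsI)
    show "\<theta> i \<le> N" if "i \<le> n" for i using that assms \<open>\<theta> ` {..n} = U\<close> by auto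
    show "\<theta> i \<le> \<theta> j" if "i \<le> j" "j \<le> n" for i j
      using that strict_mono_on_leD[OF h(2), of i j] by (simp add: \<theta>_def s)
  qed (simp add: \<theta>_def)
  ultimately show ?thesis using that by blast
qed

text \<open>One pushout along the inclusion \<open>face_union n L \<subseteq> std_simplex n\<close>, attached along an injection.\<close>

lemma extend_along_face:
  assumes K: "down_closed K" and th: "\<theta> \<in> ord_maps n N" "inj_on \<theta> {..n}"
    and faces: "\<And>l. l \<in> L \<Longrightarrow> \<theta> ` ({..n} - {l}) \<in> K" and new: "\<theta> ` L \<notin> K"
    and ext: "has_extensions X (face_union n L) n"
    and f: "simplicial_map (subcomplex N K) X f"
  obtains h where "simplicial_map (subcomplex N (K \<union> Pow (\<theta> ` {..n}))) X h"
    "\<And>m \<sigma>. \<sigma> \<in> simplices (subcomplex N K) m \<Longrightarrow> h m \<sigma> = f m \<sigma>"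
proof -
  have "simplicial_map (face_union n L) X (\<lambda>m \<sigma>. f m (compose {..m} \<theta> \<sigma>))"
    unfolding face_union_eq_subcomplex
  proof (rule simplicial_map_pullback[OF f th(1)])
    fix S assume "S \<subseteq> {..n}" "S \<in> {S. \<not> L \<subseteq> S}"
    then obtain l where "l \<in> L" "S \<subseteq> {..n} - {l}" by auto
    then show "\<theta> ` S \<in> K" using faces K down_closedD by (meson image_mono)
  qed
  with ext obtain g where g: "simplicial_map (subcomplex n UNIV) X g"
    and gf: "\<And>m \<sigma>. \<sigma> \<in> ord_maps m n \<Longrightarrow> \<not> L \<subseteq> \<sigma> ` {..m} \<Longrightarrow> g m \<sigma> = f m (compose {..m} \<theta> \<sigma>)"
    unfolding has_extensions_def face_union_eq_subcomplex std_simplex_eq_subcomplex by auto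
  obtain \<rho> where \<rho>: "\<rho> \<in> ord_maps N n" "\<And>k. k \<le> n \<Longrightarrow> \<rho> (\<theta> k) = k"
    using ord_maps_retraction[OF th] by blast
  \<comment> \<open>A simplex with vertices in the image of \<open>\<theta>\<close> is recovered
    from its composite with \<open>\<rho>\<close>, so \<open>\<rho>\<close> transports the filler
    \<open>g\<close> to that image.\<close>
  have g': "simplicial_map (subcomplex N (Pow (\<theta> ` {..n}))) X (\<lambda>m \<sigma>. g m (compose {..m} \<rho> \<sigma>))"
    by (rule simplicial_map_pullback[OF g \<rho>(1)]) simp
  have eq: "f m \<sigma> = g m (compose {..m} \<rho> \<sigma>)"
    if \<sigma>: "\<sigma> \<in> ord_maps m N" "\<sigma> ` {..m} \<in> K" "\<sigma> ` {..m} \<in> Pow (\<theta> ` {..n})" for m \<sigma>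
  proof -
    have id: "\<theta> (\<rho> x) = x" if "x \<in> \<sigma> ` {..m}" for x
      using that \<sigma>(3) \<rho>(2) by auto
    \<comment> \<open>If all of \<open>L\<close> occurred, downward closure would put the image of
      \<open>L\<close> under \<open>\<theta>\<close> into \<open>K\<close>, against
      \<open>new\<close>.\<close>
    have "\<not> L \<subseteq> compose {..m} \<rho> \<sigma> ` {..m}"
    proof
      assume "L \<subseteq> compose {..m} \<rho> \<sigma> ` {..m}"
      then have "\<theta> ` L \<subseteq> \<sigma> ` {..m}" using id by (auto simp: image_compose)
      then show False using \<sigma>(2) K new down_closedD by blast
    qed
    then have "g m (compose {..m} \<rho> \<sigma>) = f m (compose {..m} \<theta> (compose {..m} \<rho> \<sigma>))"
      using gf ord_maps_compose[OF \<sigma>(1) \<rho>(1)] by blast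
    also have "compose {..m} \<theta> (compose {..m} \<rho> \<sigma>) = \<sigma>"
      using id ord_maps_undefined[OF \<sigma>(1)] by (auto simp: compose_def restrict_def fun_eq_iff)
    finally show ?thesis by simp
  qed
  show ?thesis
    by (rule simplicial_map_glue[OF f g' K _ eq]) (use that in \<open>auto simp: down_closed_def\<close>)
qed

text \<open>A witness needs one vertex strictly between \<open>i\<close> and \<open>j\<close> and
  one outside, for which \<open>0\<close> or \<open>n\<close> serves: both arcs into which the pair
  cuts the cyclic order must be nonempty.\<close>

lemma broken_pair:
  assumes "i < j"
  shows "broken n {i, j} \<longleftrightarrow> Suc i < j \<and> j \<le> n \<and> (0 < i \<or> j < n)"
proof
  assume "broken n {i, j}"
  then show "Suc i < j \<and> j \<le> n \<and> (0 < i \<or> j < n)"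
    unfolding broken_def using assms by auto
next
  assume *: "Suc i < j \<and> j \<le> n \<and> (0 < i \<or> j < n)"
  then consider "0 < i" | "j < n" by blast
  then show "broken n {i, j}"
  proof cases
    case 1
    have "0 < i \<and> i < Suc i \<and> Suc i < j \<and> j \<le> n" using * 1 by simp
    then show ?thesis unfolding broken_def using *
      by (intro conjI exI[of _ 0] exI[of _ i] exI[of _ "Suc i"] exI[of _ j]) auto
  next
    case 2
    then show ?thesis unfolding broken_def using *
      by (intro conjI exI[of _ i] exI[of _ "Suc i"] exI[of _ j] exI[of _ n]) auto
  qed
qed

text \<open>The missing simplices come in quadruples \<open>B\<close>, \<open>B \<union> {a}\<close>, \<open>B \<union> {b}\<close>, \<open>B \<union> {a, b}\<close>; taking \<open>B\<close>
  minimal, such a quadruple is attached along a 2-Segal horn of the simplex on \<open>B \<union> {a, b}\<close>.\<close>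

lemma has_extensions_by_pair:
  assumes ab: "a < b" "b \<le> N"
    and K: "down_closed K" and ins: "\<And>S. S \<in> K \<Longrightarrow> insert a (insert b S) \<in> K"
    and brk: "\<And>B. B \<subseteq> {..N} \<Longrightarrow> B \<notin> K \<Longrightarrow> (\<exists>c\<in>B. a < c \<and> c < b) \<and> (\<exists>d\<in>B. d < a \<or> b < d)"
    and ext: "\<And>n i j. i < j \<Longrightarrow> broken n {i, j} \<Longrightarrow> (a = 0 \<Longrightarrow> i = 0) \<Longrightarrow> (b = N \<Longrightarrow> j = n) \<Longrightarrow>
      has_extensions X (two_segal_horn n i j) n"
  shows "has_extensions X (subcomplex N K) N"
  using K ins brk
proof (induction "card (Pow {..N} - K)" arbitrary: K rule: less_induct)
  case less
  show ?case
  proof (cases "Pow {..N} \<subseteq> K")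
    case True
    then have "subcomplex N K = std_simplex N"
      unfolding std_simplex_eq_subcomplex by (intro subcomplex_eq) auto
    then show ?thesis unfolding has_extensions_def by auto
  next
    case False
    then obtain B where B: "B \<subseteq> {..N}" "B \<notin> K"
      and min: "\<And>C. C \<subseteq> {..N} \<Longrightarrow> C \<notin> K \<Longrightarrow> card B \<le> card C"
      using ex_has_least_nat[of "\<lambda>B. B \<subseteq> {..N} \<and> B \<notin> K" _ card]
      by (metis (no_types, lifting) PowD subsetI)
    have finB: "finite B" using B(1) finite_subset by blast
    have smaller: "C \<in> K" if "C \<subset> B" for C
      using min[of C] psubset_card_mono[OF finB that] that B(1) by auto
    \<comment> \<open>If \<open>B - {a, b}\<close> were in \<open>K\<close>, adding \<open>a\<close>
      and \<open>b\<close> would put a superset of \<open>B\<close> into \<open>K\<close>.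
      Minimality then forces \<open>B\<close> to avoid both.\<close>
    have "B - {a, b} \<notin> K"
      using less.prems(2)[of "B - {a, b}"] down_closedD[OF less.prems(1), of _ B] B(2) by blast
    then have "\<not> B - {a, b} \<subset> B" using smaller by blast
    then have notin: "a \<notin> B" "b \<notin> B" by auto
    define S where "S = insert a (insert b B)"
    have S: "S \<subseteq> {..N}" "S \<noteq> {}" using B ab by (auto simp: S_def)
    obtain n \<theta> where th: "\<theta> \<in> ord_maps n N" "inj_on \<theta> {..n}" "\<theta> ` {..n} = S"
      using ord_maps_enumeration[OF S] .
    have lt: "\<theta> x < \<theta> y \<longleftrightarrow> x < y" if "x \<le> n" "y \<le> n" for x y
      using ord_maps_mono[OF th(1), of x y] ord_maps_mono[OF th(1), of y x] th(2) that
      by (metis atMost_iff inj_on_def linorder_not_less nat_less_le)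
    have "a \<in> \<theta> ` {..n}" "b \<in> \<theta> ` {..n}" by (simp_all add: th(3) S_def)
    then obtain i j where ij: "i \<le> n" "\<theta> i = a" "j \<le> n" "\<theta> j = b" by auto
    have "i < j" using ij ab lt by auto
    obtain c d where cd: "c \<in> B" "a < c" "c < b" "d \<in> B" "d < a \<or> b < d"
      using less.prems(3)[OF B] by (elim conjE bexE)
    have "c \<in> \<theta> ` {..n}" "d \<in> \<theta> ` {..n}" using cd by (simp_all add: th(3) S_def)
    then obtain c' d' where cd': "c' \<le> n" "\<theta> c' = c" "d' \<le> n" "\<theta> d' = d" by auto
    have "i < c'" "c' < j" "d' < i \<or> j < d'" using lt ij cd cd' by auto
    then have "broken n {i, j}" using \<open>i < j\<close> ij cd' by (subst broken_pair) auto
    \<comment> \<open>An extreme vertex of the large simplex stays extreme in the simplex on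
      \<open>S\<close>. For \<open>a = 0\<close> or \<open>b = N\<close> this restricts the horns in
      use to those at \<open>{0, j}\<close> or \<open>{i, n}\<close>.\<close>
    moreover have "i = 0" if "a = 0"
      using that lt[of 0 i] ij by auto
    moreover have "j = n" if "b = N"
      using that lt[of j n] ij ord_maps_le[OF th(1), of n] by auto
    ultimately have he: "has_extensions X (face_union n ({..n} - {i, j})) n"
      using ext[OF \<open>i < j\<close>] by (simp add: two_segal_horn_def)
    have imL: "\<theta> ` ({..n} - {i, j}) = B"
      using th ij notin inj_on_image_set_diff[OF th(2), of "{..n}" "{i, j}"] by (auto simp: S_def)
    let ?K = "K \<union> Pow S"
    have IH: "has_extensions X (subcomplex N ?K) N"
    proof (rule less.hyps)
      have "B \<in> Pow {..N} - K" "B \<in> ?K" using B by (auto simp: S_def)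
      then show "card (Pow {..N} - ?K) < card (Pow {..N} - K)"
        by (intro psubset_card_mono) auto
      show "down_closed ?K" using less.prems(1) unfolding down_closed_def by blast
      show "insert a (insert b C) \<in> ?K" if "C \<in> ?K" for C
        using that less.prems(2) by (auto simp: S_def)
    qed (use less.prems(3) in auto)
    show ?thesis
      unfolding has_extensions_def
    proof (intro allI impI)
      fix f assume f: "simplicial_map (subcomplex N K) X f"
      obtain h where h: "simplicial_map (subcomplex N ?K) X h"
        "\<And>m \<sigma>. \<sigma> \<in> simplices (subcomplex N K) m \<Longrightarrow> h m \<sigma> = f m \<sigma>"
      proof (rule extend_along_face[OF less.prems(1) th(1,2) _ _ he f])
        \<comment> \<open>The face opposite such an \<open>l\<close> is a proper subset of
          \<open>B\<close> with \<open>a\<close> and \<open>b\<close> added, hence in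
          \<open>K\<close> by minimality.\<close>
        fix l assume "l \<in> {..n} - {i, j}"
        moreover have "\<theta> ` ({..n} - {l}) = S - {\<theta> l}" if "l \<le> n"
          using th(3) inj_on_image_set_diff[OF th(2), of "{..n}" "{l}"] that by auto
        moreover have "\<theta> l \<in> B" using calculation(1) imL by blast
        ultimately have "\<theta> ` ({..n} - {l}) = insert a (insert b (B - {\<theta> l}))"
          using notin by (auto simp: S_def)
        moreover have "B - {\<theta> l} \<in> K" using smaller \<open>\<theta> l \<in> B\<close> by blast
        ultimately show "\<theta> ` ({..n} - {l}) \<in> K" using less.prems(2) by auto
      next
        show "\<theta> ` ({..n} - {i, j}) \<notin> K" using imL B(2) by simp
      qed (use th(3) that in auto)
      with IH show "\<exists>g. simplicial_map (std_simplex N) X g \<and>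
          (\<forall>m. \<forall>\<sigma>\<in>simplices (subcomplex N K) m. g m \<sigma> = f m \<sigma>)"
        unfolding has_extensions_def by (metis (no_types, lifting) UnI1 mem_Collect_eq subcomplex_simplices)
    qed
  qed
qed

section \<open>Vertex indices in the doubled simplex and factorizations through
  \<open>eps_map\<close>\<close>

text \<open>In \<open>[m]\<^sup>o\<^sup>p \<star> [m]\<close>, the copies \<open>m - k\<close> and \<open>m + 1 + k\<close> of the vertex \<open>k\<close> have index \<open>k\<close>.\<close>

definition esd_index :: "nat \<Rightarrow> nat \<Rightarrow> nat" where
  "esd_index m y = (if y \<le> m then m - y else y - (m + 1))"

lemma esd_index_eps_map:
  assumes "\<phi> \<in> ord_maps q m" "x \<le> 2 * q + 1"
  shows "esd_index m (eps_map q m \<phi> x) = \<phi> (esd_index q x)"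
  using assms ord_maps_le[OF assms(1), of "q - x"] by (auto simp: esd_index_def eps_map_def)

lemma esd_index_image: "esd_index m ` {..2 * m + 1} = {..m}"
proof
  show "{..m} \<subseteq> esd_index m ` {..2 * m + 1}"
  proof
    fix k assume "k \<in> {..m}"
    then show "k \<in> esd_index m ` {..2 * m + 1}"
      by (intro image_eqI[of _ _ "m - k"]) (auto simp: esd_index_def)
  qed
qed (auto simp: esd_index_def)

lemma esd_index_image_eps_map:
  assumes "\<phi> \<in> ord_maps q m"
  shows "esd_index m ` eps_map q m \<phi> ` {..2 * q + 1} = \<phi> ` {..q}"
proof -
  have "esd_index m ` eps_map q m \<phi> ` {..2 * q + 1} = \<phi> ` esd_index q ` {..2 * q + 1}"
    using esd_index_eps_map[OF assms] by (simp add: image_image)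
  then show ?thesis by (simp only: esd_index_image)
qed

text \<open>\<open>eps_map\<close> treats both copies of a vertex alike, so its image is the full
  preimage under \<open>esd_index\<close> of the image of \<open>\<phi>\<close>.\<close>

lemma eps_map_image_iff:
  assumes "\<phi> \<in> ord_maps q m" "y \<le> 2 * m + 1"
  shows "y \<in> eps_map q m \<phi> ` {..2 * q + 1} \<longleftrightarrow> esd_index m y \<in> \<phi> ` {..q}"
proof
  assume "y \<in> eps_map q m \<phi> ` {..2 * q + 1}"
  then show "esd_index m y \<in> \<phi> ` {..q}" using esd_index_image_eps_map[OF assms(1)] by blast
next
  assume "esd_index m y \<in> \<phi> ` {..q}"
  then obtain k where k: "k \<le> q" "esd_index m y = \<phi> k" by auto
  show "y \<in> eps_map q m \<phi> ` {..2 * q + 1}"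
  proof (cases "y \<le> m")
    case True
    then have "eps_map q m \<phi> (q - k) = y"
      using k ord_maps_le[OF assms(1), of k] by (auto simp: eps_map_op esd_index_def)
    then show ?thesis by (intro image_eqI[of _ _ "q - k"]) auto
  next
    case False
    then have "eps_map q m \<phi> (q + 1 + k) = y"
      using k by (subst eps_map_id) (auto simp: esd_index_def)
    then show ?thesis using k(1) by (intro image_eqI[of _ _ "q + 1 + k"]) auto
  qed
qed

text \<open>A vertex is determined by its index and the copy it lies in, and \<open>eps_map\<close>
  preserves the copy.\<close>

lemma inj_on_eps_map:
  assumes "\<phi> \<in> ord_maps q m" "inj_on \<phi> {..q}"
  shows "inj_on (eps_map q m \<phi>) {..2 * q + 1}"
proof (rule inj_onI)
  fix x y assume xy: "x \<in> {..2 * q + 1}" "y \<in> {..2 * q + 1}" "eps_map q m \<phi> x = eps_map q m \<phi> y"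
  then have "\<phi> (esd_index q x) = \<phi> (esd_index q y)"
    using esd_index_eps_map[OF assms(1)] by (metis atMost_iff)
  then have "esd_index q x = esd_index q y"
    using assms(2) xy by (auto simp: inj_on_def esd_index_def)
  moreover have "x \<le> q \<longleftrightarrow> y \<le> q"
    using xy by (auto simp: eps_map_def split: if_splits)
  ultimately show "x = y" using xy by (auto simp: esd_index_def split: if_splits)
qed

lemma ord_maps_factor:
  assumes "\<theta> \<in> ord_maps q n" "inj_on \<theta> {..q}" "\<sigma> \<in> ord_maps p n" "\<sigma> ` {..p} \<subseteq> \<theta> ` {..q}"
  obtains \<psi> where "\<psi> \<in> ord_maps p q" "compose {..p} \<theta> \<psi> = \<sigma>"
proof -
  obtain \<rho> where \<rho>: "\<rho> \<in> ord_maps n q" "\<And>k. k \<le> q \<Longrightarrow> \<rho> (\<theta> k) = k"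
    using ord_maps_retraction[OF assms(1,2)] by blast
  have id: "\<theta> (\<rho> x) = x" if "x \<in> \<sigma> ` {..p}" for x
    using that assms(4) \<rho>(2) by auto
  have "compose {..p} \<theta> (compose {..p} \<rho> \<sigma>) = \<sigma>"
    using id ord_maps_undefined[OF assms(3)] by (auto simp: compose_def restrict_def fun_eq_iff)
  then show ?thesis using that ord_maps_compose[OF assms(3) \<rho>(1)] by blast
qed

lemma compose_left_cancel:
  assumes "inj_on \<theta> {..q}" "\<psi> \<in> ord_maps p q" "\<psi>' \<in> ord_maps p q"
    and "compose {..p} \<theta> \<psi> = compose {..p} \<theta> \<psi>'"
  shows "\<psi> = \<psi>'"
proof
  fix x
  show "\<psi> x = \<psi>' x"
  proof (cases "x \<le> p")
    case True
    then have "\<theta> (\<psi> x) = \<theta> (\<psi>' x)" using fun_cong[OF assms(4), of x] by (simp add: compose_def)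
    then show ?thesis
      using assms(1) ord_maps_le[OF assms(2) True] ord_maps_le[OF assms(3) True] by (auto simp: inj_on_def)
  qed (use assms(2,3) in \<open>simp add: ord_maps_undefined\<close>)
qed

lemma eps_map_factor:
  assumes "\<phi> \<in> ord_maps q m" "inj_on \<phi> {..q}" "\<tau> \<in> ord_maps p (2 * m + 1)"
    and "esd_index m ` \<tau> ` {..p} \<subseteq> \<phi> ` {..q}"
  obtains \<psi> where "\<psi> \<in> ord_maps p (2 * q + 1)" "compose {..p} (eps_map q m \<phi>) \<psi> = \<tau>"
proof (rule ord_maps_factor[OF eps_map_in_ord_maps[OF assms(1)] inj_on_eps_map[OF assms(1,2)] assms(3)])
  show "\<tau> ` {..p} \<subseteq> eps_map q m \<phi> ` {..2 * q + 1}"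
    using assms(4) eps_map_image_iff[OF assms(1)] image_ord_maps[OF assms(3)] by blast
qed

text \<open>Enumerating the indices of the vertices of \<open>\<tau>\<close> gives the injection
  \<open>\<phi>\<close> with the least image whose double contains \<open>\<tau>\<close>.\<close>

lemma eps_map_factorization:
  assumes "\<tau> \<in> ord_maps p (2 * m + 1)"
  obtains q \<phi> \<psi> where "\<phi> \<in> ord_maps q m" "inj_on \<phi> {..q}" "\<phi> ` {..q} = esd_index m ` \<tau> ` {..p}"
    "\<psi> \<in> ord_maps p (2 * q + 1)" "compose {..p} (eps_map q m \<phi>) \<psi> = \<tau>"
proof -
  have U: "esd_index m ` \<tau> ` {..p} \<subseteq> {..m}" "esd_index m ` \<tau> ` {..p} \<noteq> {}"
    using image_mono[OF image_ord_maps[OF assms], of "esd_index m"] esd_index_image by auto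
  obtain q \<phi> where \<phi>: "\<phi> \<in> ord_maps q m" "inj_on \<phi> {..q}" "\<phi> ` {..q} = esd_index m ` \<tau> ` {..p}"
    using ord_maps_enumeration[OF U] .
  show ?thesis
    by (rule eps_map_factor[OF \<phi>(1,2) assms]) (use \<phi> that in auto)
qed

section \<open>Transposing extension problems between \<open>X\<close> and
  \<open>esd X\<close>\<close>

text \<open>The left Kan extension of \<open>face_union m L\<close> along \<open>\<epsilon>\<close>, as a subcomplex of the simplex of
  dimension \<open>2 * m + 1\<close>.\<close>

definition esd_faces :: "nat \<Rightarrow> nat set \<Rightarrow> nat set set" where
  "esd_faces m L = {S. \<not> L \<subseteq> esd_index m ` S}"

text \<open>Restricting \<open>F\<close> to doubled simplices gives a map into \<open>esd X\<close>.
  By the Yoneda lemma its extension is given by the value \<open>x\<close> at the identity, and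
  \<open>x\<close> is also a \<open>(2 * m + 1)\<close>-simplex of \<open>X\<close>, which
  represents the required extension of \<open>F\<close>.\<close>

lemma has_extensions_esd_faces:
  assumes X: "simplicial_set X" and ext: "has_extensions (esd X) (face_union m L) m"
  shows "has_extensions X (subcomplex (2 * m + 1) (esd_faces m L)) (2 * m + 1)"
  unfolding has_extensions_def
proof (intro allI impI)
  interpret simplicial_set X by fact
  fix F assume F: "simplicial_map (subcomplex (2 * m + 1) (esd_faces m L)) X F"
  define f where "f q \<phi> = F (2 * q + 1) (eps_map q m \<phi>)" for q \<phi>
  have dom: "eps_map q m \<phi> \<in> simplices (subcomplex (2 * m + 1) (esd_faces m L)) (2 * q + 1)"
    if "\<phi> \<in> simplices (face_union m L) q" for q \<phi>
    using that eps_map_in_ord_maps[of \<phi> q m] esd_index_image_eps_map[of \<phi> q m]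
    by (auto simp: face_union_eq_subcomplex esd_faces_def)
  have "simplicial_map (face_union m L) (esd X) f"
    unfolding simplicial_map_def
  proof (intro conjI allI ballI)
    fix q \<phi> assume "\<phi> \<in> simplices (face_union m L) q"
    from dom[OF this] show "f q \<phi> \<in> simplices (esd X) q"
      using F unfolding simplicial_map_def f_def esd_def by auto
  next
    fix p q \<chi> \<phi> assume \<chi>: "\<chi> \<in> ord_maps p q" and \<phi>: "\<phi> \<in> simplices (face_union m L) q"
    have "\<phi> \<in> ord_maps q m" using \<phi> by (simp add: face_union_eq_subcomplex)
    then show "f p (act (face_union m L) p q \<chi> \<phi>) = act (esd X) p q \<chi> (f q \<phi>)"
      using F dom[OF \<phi>] eps_map_in_ord_maps[OF \<chi>]
      by (simp add: face_union_eq_subcomplex f_def esd_def eps_map_compose[OF \<chi>] simplicial_map_def)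
  qed
  with ext obtain g where g: "simplicial_map (std_simplex m) (esd X) g"
    and gf: "\<And>q \<phi>. \<phi> \<in> ord_maps q m \<Longrightarrow> \<not> L \<subseteq> \<phi> ` {..q} \<Longrightarrow> g q \<phi> = f q \<phi>"
    unfolding has_extensions_def by (auto simp: face_union_eq_subcomplex)
  have id: "ord_id m \<in> ord_maps m m" by (rule ord_mapsI) (auto simp: ord_id_def)
  define x where "x = g m (ord_id m)"
  have x: "x \<in> simplices X (2 * m + 1)"
    using g id by (auto simp: x_def simplicial_map_def std_simplex_def esd_def)
  have gx: "act X (2 * q + 1) (2 * m + 1) (eps_map q m \<phi>) x = g q \<phi>" if \<phi>: "\<phi> \<in> ord_maps q m" for q \<phi>
  proof -
    have "act (esd X) q m \<phi> x = g q (compose {..q} (ord_id m) \<phi>)"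
      using g id \<phi> unfolding simplicial_map_def x_def by (simp add: std_simplex_def)
    also have "compose {..q} (ord_id m) \<phi> = \<phi>"
      using image_ord_maps[OF \<phi>] by (intro compose_eq_self[OF \<phi>]) (auto simp: ord_id_def)
    finally show ?thesis by (simp add: esd_def)
  qed
  show "\<exists>G. simplicial_map (std_simplex (2 * m + 1)) X G \<and>
      (\<forall>p. \<forall>\<tau>\<in>simplices (subcomplex (2 * m + 1) (esd_faces m L)) p. G p \<tau> = F p \<tau>)"
  proof (intro exI conjI allI ballI)
    show "simplicial_map (std_simplex (2 * m + 1)) X (\<lambda>p \<tau>. act X p (2 * m + 1) \<tau> x)"
      using x act_closed act_comp by (auto simp: simplicial_map_def std_simplex_def)
    fix p \<tau> assume "\<tau> \<in> simplices (subcomplex (2 * m + 1) (esd_faces m L)) p"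
    then have \<tau>: "\<tau> \<in> ord_maps p (2 * m + 1)" "\<not> L \<subseteq> esd_index m ` \<tau> ` {..p}"
      by (auto simp: esd_faces_def)
    obtain q \<phi> \<psi> where *: "\<phi> \<in> ord_maps q m" "\<phi> ` {..q} = esd_index m ` \<tau> ` {..p}"
      "\<psi> \<in> ord_maps p (2 * q + 1)" "compose {..p} (eps_map q m \<phi>) \<psi> = \<tau>"
      using eps_map_factorization[OF \<tau>(1)] by metis
    have "\<phi> \<in> simplices (face_union m L) q" using * \<tau> by (simp add: face_union_eq_subcomplex)
    note \<phi> = dom[OF this]
    \<comment> \<open>Every simplex of the subcomplex comes by a simplicial operator from a doubled
      simplex of the face union, where both maps agree.\<close>
    have "act X p (2 * m + 1) \<tau> x = act X p (2 * q + 1) \<psi> (g q \<phi>)"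
      using act_comp[OF *(3) eps_map_in_ord_maps[OF *(1)] x] *(4) gx[OF *(1)] by simp
    also have "g q \<phi> = F (2 * q + 1) (eps_map q m \<phi>)" using gf[OF *(1)] *(2) \<tau>(2) by (simp add: f_def)
    also have "act X p (2 * q + 1) \<psi> \<dots> = F p \<tau>"
      using F \<phi> *(3,4) unfolding simplicial_map_def by (metis subcomplex_act)
    finally show "act X p (2 * m + 1) \<tau> x = F p \<tau>" .
  qed
qed

text \<open>A map on the face union transposes to the subcomplex: its value at \<open>\<tau>\<close>
  is computed from a factorization of \<open>\<tau>\<close> through a doubled simplex of the face
  union, and the work lies in independence of the factorization.\<close>

lemma has_extensions_esd:
  assumes X: "simplicial_set X"
    and ext: "has_extensions X (subcomplex (2 * m + 1) (esd_faces m L)) (2 * m + 1)"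
  shows "has_extensions (esd X) (face_union m L) m"
  unfolding has_extensions_def
proof (intro allI impI)
  interpret simplicial_set X by fact
  fix f assume f: "simplicial_map (face_union m L) (esd X) f"
  have f_closed: "f q \<phi> \<in> simplices X (2 * q + 1)" if "\<phi> \<in> ord_maps q m" "\<not> L \<subseteq> \<phi> ` {..q}" for q \<phi>
    using f that by (auto simp: simplicial_map_def esd_def face_union_eq_subcomplex)
  have f_act: "f p (compose {..p} \<phi> \<chi>) = act X (2 * p + 1) (2 * q + 1) (eps_map p q \<chi>) (f q \<phi>)"
    if "\<phi> \<in> ord_maps q m" "\<not> L \<subseteq> \<phi> ` {..q}" "\<chi> \<in> ord_maps p q" for p q \<phi> \<chi>
    using f that by (auto simp: simplicial_map_def esd_def face_union_eq_subcomplex)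
  \<comment> \<open>\<open>tight\<close> demands the least index set and serves to define
    \<open>F\<close>; the looser \<open>factors\<close> is stable under precomposition, as
    naturality of \<open>F\<close> requires.\<close>
  define factors where "factors p \<tau> q \<phi> \<psi> \<longleftrightarrow> \<phi> \<in> ord_maps q m \<and> inj_on \<phi> {..q} \<and>
    \<psi> \<in> ord_maps p (2 * q + 1) \<and> compose {..p} (eps_map q m \<phi>) \<psi> = \<tau>" for p \<tau> q \<phi> \<psi>
  define tight where "tight p \<tau> q \<phi> \<psi> \<longleftrightarrow> factors p \<tau> q \<phi> \<psi> \<and> \<phi> ` {..q} = esd_index m ` \<tau> ` {..p}"
    for p \<tau> q \<phi> \<psi>
  define F where "F p \<tau> = (SOME y. \<exists>q \<phi> \<psi>. tight p \<tau> q \<phi> \<psi> \<and> y = act X p (2 * q + 1) \<psi> (f q \<phi>))" for p \<tau>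
  have F_eq: "F p \<tau> = act X p (2 * q' + 1) \<psi>' (f q' \<phi>')"
    if \<tau>: "\<tau> \<in> ord_maps p (2 * m + 1)" and factors: "factors p \<tau> q' \<phi>' \<psi>'" and L: "\<not> L \<subseteq> \<phi>' ` {..q'}"
    for p \<tau> q' \<phi>' \<psi>'
  proof -
    have "\<exists>y q \<phi> \<psi>. tight p \<tau> q \<phi> \<psi> \<and> y = act X p (2 * q + 1) \<psi> (f q \<phi>)"
      using eps_map_factorization[OF \<tau>] unfolding tight_def factors_def by metis
    then have "\<exists>q \<phi> \<psi>. tight p \<tau> q \<phi> \<psi> \<and> F p \<tau> = act X p (2 * q + 1) \<psi> (f q \<phi>)"
      unfolding F_def by (rule someI_ex)
    then obtain q \<phi> \<psi> where t: "\<phi> \<in> ord_maps q m" "\<psi> \<in> ord_maps p (2 * q + 1)"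
        "compose {..p} (eps_map q m \<phi>) \<psi> = \<tau>" "\<phi> ` {..q} = esd_index m ` \<tau> ` {..p}"
      and F: "F p \<tau> = act X p (2 * q + 1) \<psi> (f q \<phi>)"
      unfolding tight_def factors_def by blast
    from factors have t': "\<phi>' \<in> ord_maps q' m" "inj_on \<phi>' {..q'}" "\<psi>' \<in> ord_maps p (2 * q' + 1)"
        "compose {..p} (eps_map q' m \<phi>') \<psi>' = \<tau>"
      unfolding factors_def by auto
    have "\<tau> ` {..p} \<subseteq> eps_map q' m \<phi>' ` {..2 * q' + 1}"
      using image_ord_maps[OF t'(3)] t'(4) by (metis image_compose image_mono)
    then have "\<phi> ` {..q} \<subseteq> \<phi>' ` {..q'}"
      unfolding t(4) using esd_index_image_eps_map[OF t'(1)] by blast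
    \<comment> \<open>The least choice \<open>\<phi>\<close> factors through \<open>\<phi>'\<close>
      by \<open>\<chi>\<close>. Since the double of \<open>\<phi>'\<close> is injective,
      \<open>\<psi>'\<close> must be the double of \<open>\<chi>\<close> composed with
      \<open>\<psi>\<close>.\<close>
    then obtain \<chi> where \<chi>: "\<chi> \<in> ord_maps q q'" "compose {..q} \<phi>' \<chi> = \<phi>"
      using ord_maps_factor[OF t'(1,2) t(1)] by blast
    have c: "compose {..p} (eps_map q q' \<chi>) \<psi> \<in> ord_maps p (2 * q' + 1)"
      using ord_maps_compose[OF t(2) eps_map_in_ord_maps[OF \<chi>(1)]] .
    have "compose {..p} (eps_map q' m \<phi>') (compose {..p} (eps_map q q' \<chi>) \<psi>)
        = compose {..p} (eps_map q' m \<phi>') \<psi>'"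
      using t(3) t'(4) eps_map_compose[OF \<chi>(1) t'(1)] \<chi>(2)
      by (simp add: compose_assoc_ord[OF t(2), symmetric])
    then have "compose {..p} (eps_map q q' \<chi>) \<psi> = \<psi>'"
      by (rule compose_left_cancel[OF inj_on_eps_map[OF t'(1,2)] c t'(3)])
    then show ?thesis
      using F f_act[OF t'(1) L \<chi>(1)] \<chi>(2) act_comp[OF t(2) eps_map_in_ord_maps[OF \<chi>(1)] f_closed[OF t'(1) L]]
      by simp
  qed
  have factorize: "\<exists>q \<phi> \<psi>. factors p \<tau> q \<phi> \<psi> \<and> \<not> L \<subseteq> \<phi> ` {..q}"
    if "\<tau> \<in> simplices (subcomplex (2 * m + 1) (esd_faces m L)) p" for p \<tau>
  proof -
    have \<tau>: "\<tau> \<in> ord_maps p (2 * m + 1)" "\<not> L \<subseteq> esd_index m ` \<tau> ` {..p}"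
      using that by (auto simp: esd_faces_def)
    show ?thesis
    proof (rule eps_map_factorization[OF \<tau>(1)])
      fix q \<phi> \<psi> assume "\<phi> \<in> ord_maps q m" "inj_on \<phi> {..q}" "\<phi> ` {..q} = esd_index m ` \<tau> ` {..p}"
        "\<psi> \<in> ord_maps p (2 * q + 1)" "compose {..p} (eps_map q m \<phi>) \<psi> = \<tau>"
      then have "factors p \<tau> q \<phi> \<psi> \<and> \<not> L \<subseteq> \<phi> ` {..q}" using \<tau>(2) by (simp add: factors_def)
      then show ?thesis by blast
    qed
  qed
  have "simplicial_map (subcomplex (2 * m + 1) (esd_faces m L)) X F"
    unfolding simplicial_map_def
  proof (intro conjI allI ballI)
    fix p \<tau> assume \<tau>: "\<tau> \<in> simplices (subcomplex (2 * m + 1) (esd_faces m L)) p"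
    obtain q \<phi> \<psi> where t: "factors p \<tau> q \<phi> \<psi>" "\<not> L \<subseteq> \<phi> ` {..q}" using factorize[OF \<tau>] by blast
    have "F p \<tau> = act X p (2 * q + 1) \<psi> (f q \<phi>)" using F_eq[OF _ t] \<tau> by simp
    then show "F p \<tau> \<in> simplices X p"
      using t f_closed[of \<phi> q] act_closed[of \<psi>] by (simp add: factors_def)
  next
    fix l p \<theta> \<tau> assume \<theta>: "\<theta> \<in> ord_maps l p"
      and \<tau>: "\<tau> \<in> simplices (subcomplex (2 * m + 1) (esd_faces m L)) p"
    obtain q \<phi> \<psi> where t: "factors p \<tau> q \<phi> \<psi>" "\<not> L \<subseteq> \<phi> ` {..q}" using factorize[OF \<tau>] by blast
    have "factors l (compose {..l} \<tau> \<theta>) q \<phi> (compose {..l} \<psi> \<theta>)"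
      using t(1) ord_maps_compose[OF \<theta>] by (auto simp: factors_def compose_assoc_ord[OF \<theta>, symmetric])
    moreover have "compose {..l} \<tau> \<theta> \<in> ord_maps l (2 * m + 1)"
      using ord_maps_compose[OF \<theta>] \<tau> by simp
    ultimately have "F l (compose {..l} \<tau> \<theta>) = act X l (2 * q + 1) (compose {..l} \<psi> \<theta>) (f q \<phi>)"
      using F_eq t(2) by blast
    also have "\<dots> = act X l p \<theta> (act X p (2 * q + 1) \<psi> (f q \<phi>))"
      using act_comp[OF \<theta>, of \<psi>] t f_closed[of \<phi> q] by (simp add: factors_def)
    also have "act X p (2 * q + 1) \<psi> (f q \<phi>) = F p \<tau>" using F_eq[OF _ t] \<tau> by simp
    finally show "F l (act (subcomplex (2 * m + 1) (esd_faces m L)) l p \<theta> \<tau>) = act X l p \<theta> (F p \<tau>)"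
      by simp
  qed
  with ext obtain G where G: "simplicial_map (std_simplex (2 * m + 1)) X G"
    and GF: "\<And>p \<tau>. \<tau> \<in> ord_maps p (2 * m + 1) \<Longrightarrow> \<tau> ` {..p} \<in> esd_faces m L \<Longrightarrow> G p \<tau> = F p \<tau>"
    unfolding has_extensions_def by auto
  show "\<exists>g. simplicial_map (std_simplex m) (esd X) g \<and>
      (\<forall>q. \<forall>\<phi>\<in>simplices (face_union m L) q. g q \<phi> = f q \<phi>)"
  proof (intro exI conjI allI ballI)
    show "simplicial_map (std_simplex m) (esd X) (\<lambda>q \<phi>. G (2 * q + 1) (eps_map q m \<phi>))"
      using G eps_map_in_ord_maps
      by (auto simp: simplicial_map_def std_simplex_def esd_def eps_map_compose)
    fix q \<phi> assume "\<phi> \<in> simplices (face_union m L) q"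
    then have \<phi>: "\<phi> \<in> ord_maps q m" "\<not> L \<subseteq> \<phi> ` {..q}" by (auto simp: face_union_eq_subcomplex)
    \<comment> \<open>\<open>\<phi>\<close> may repeat vertices while \<open>factors\<close> asks
      for an injection, so \<open>\<phi>\<close> is written as an enumeration
      \<open>\<theta>\<close> of its image composed with \<open>\<chi>\<close>.\<close>
    obtain r \<theta> where \<theta>: "\<theta> \<in> ord_maps r m" "inj_on \<theta> {..r}" "\<theta> ` {..r} = \<phi> ` {..q}"
      by (rule ord_maps_enumeration[OF image_ord_maps[OF \<phi>(1)]]) auto
    obtain \<chi> where \<chi>: "\<chi> \<in> ord_maps q r" "compose {..q} \<theta> \<chi> = \<phi>"
      using ord_maps_factor[OF \<theta>(1,2) \<phi>(1)] \<theta>(3) by blast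
    have eps: "eps_map q m \<phi> \<in> ord_maps (2 * q + 1) (2 * m + 1)" using eps_map_in_ord_maps[OF \<phi>(1)] .
    have "G (2 * q + 1) (eps_map q m \<phi>) = F (2 * q + 1) (eps_map q m \<phi>)"
      using GF[OF eps] \<phi>(2) esd_index_image_eps_map[OF \<phi>(1)] by (simp add: esd_faces_def)
    also have "\<dots> = act X (2 * q + 1) (2 * r + 1) (eps_map q r \<chi>) (f r \<theta>)"
      using \<theta> \<phi>(2) \<chi> eps_map_in_ord_maps[OF \<chi>(1)] eps_map_compose[OF \<chi>(1) \<theta>(1)]
      by (intro F_eq[OF eps]) (auto simp: factors_def)
    also have "\<dots> = f q \<phi>" using f_act[OF \<theta>(1) _ \<chi>(1)] \<theta>(3) \<phi>(2) \<chi>(2) by simp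
    finally show "G (2 * q + 1) (eps_map q m \<phi>) = f q \<phi>" .
  qed
qed

section \<open>Inner horns of \<open>esd X\<close>, and 2-Segal horns at an extreme vertex\<close>

text \<open>The problem is pulled back along \<open>r\<close> to the large simplex and solved there,
  and the solution is restricted along \<open>s\<close>; it solves the original problem because
  \<open>r\<close> after \<open>s\<close> is the identity.\<close>

lemma has_extensions_retract:
  assumes ext: "has_extensions X (subcomplex M K) M"
    and s: "s \<in> ord_maps n M" and r: "r \<in> ord_maps M n" and rs: "\<And>k. k \<le> n \<Longrightarrow> r (s k) = k"
    and sK: "\<And>S. S \<subseteq> {..n} \<Longrightarrow> S \<in> K' \<Longrightarrow> s ` S \<in> K"
    and rK: "\<And>S. S \<subseteq> {..M} \<Longrightarrow> S \<in> K \<Longrightarrow> r ` S \<in> K'"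
  shows "has_extensions X (subcomplex n K') n"
  unfolding has_extensions_def
proof (intro allI impI)
  fix f assume f: "simplicial_map (subcomplex n K') X f"
  have "simplicial_map (subcomplex M K) X (\<lambda>m \<sigma>. f m (compose {..m} r \<sigma>))"
    by (rule simplicial_map_pullback[OF f r rK])
  with ext obtain g where g: "simplicial_map (subcomplex M UNIV) X g"
    and gf: "\<And>m \<sigma>. \<sigma> \<in> ord_maps m M \<Longrightarrow> \<sigma> ` {..m} \<in> K \<Longrightarrow> g m \<sigma> = f m (compose {..m} r \<sigma>)"
    unfolding has_extensions_def std_simplex_eq_subcomplex by auto
  have "simplicial_map (subcomplex n UNIV) X (\<lambda>m \<sigma>. g m (compose {..m} s \<sigma>))"
    by (rule simplicial_map_pullback[OF g s]) simp
  moreover have "g m (compose {..m} s \<sigma>) = f m \<sigma>" if "\<sigma> \<in> simplices (subcomplex n K') m" for m \<sigma>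
  proof -
    have \<sigma>: "\<sigma> \<in> ord_maps m n" "\<sigma> ` {..m} \<in> K'" using that by auto
    have "g m (compose {..m} s \<sigma>) = f m (compose {..m} r (compose {..m} s \<sigma>))"
      using gf ord_maps_compose[OF \<sigma>(1) s] sK[OF image_ord_maps[OF \<sigma>(1)] \<sigma>(2)] by (simp add: image_compose)
    also have "compose {..m} r (compose {..m} s \<sigma>) = \<sigma>"
      using rs ord_maps_le[OF \<sigma>(1)] ord_maps_undefined[OF \<sigma>(1)]
      by (auto simp: compose_def restrict_def fun_eq_iff)
    finally show ?thesis .
  qed
  ultimately show "\<exists>g. simplicial_map (std_simplex n) X g \<and>
      (\<forall>m. \<forall>\<sigma>\<in>simplices (subcomplex n K') m. g m \<sigma> = f m \<sigma>)"
    unfolding std_simplex_eq_subcomplex by blast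
qed

text \<open>The vertices \<open>m - i\<close> and \<open>m + 1 + i\<close> have index
  \<open>i\<close>, which does not decide membership in \<open>esd_faces m ({..m} - {i})\<close>;
  adding them to a set therefore never leaves this family.\<close>

lemma esd_horn_extension:
  assumes "simplicial_set X" "0 < i" "i < m"
    and ext: "\<And>n i j. i < j \<Longrightarrow> broken n {i, j} \<Longrightarrow> has_extensions X (two_segal_horn n i j) n"
  shows "has_extensions (esd X) (horn m i) m"
  unfolding horn_def
proof (rule has_extensions_esd[OF assms(1)], rule has_extensions_by_pair)
  let ?K = "esd_faces m ({..m} - {i})"
  have idx: "esd_index m (m - i) = i" "esd_index m (m + 1 + i) = i"
    using assms(3) by (auto simp: esd_index_def)
  show "down_closed ?K"
    unfolding down_closed_def esd_faces_def by (metis image_mono mem_Collect_eq order_trans)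
  show "insert (m - i) (insert (m + 1 + i) S) \<in> ?K" if "S \<in> ?K" for S
    using that idx by (auto simp: esd_faces_def)
  show "(\<exists>c\<in>B. m - i < c \<and> c < m + 1 + i) \<and> (\<exists>d\<in>B. d < m - i \<or> m + 1 + i < d)"
    if "B \<subseteq> {..2 * m + 1}" "B \<notin> ?K" for B
  proof -
    \<comment> \<open>A set outside \<open>?K\<close> meets every index other than \<open>i\<close>.
      As \<open>i\<close> is inner, these include \<open>0\<close>, whose copies lie between the
      pair, and \<open>m\<close>, whose copies lie outside it.\<close>
    have "0 \<in> esd_index m ` B" "m \<in> esd_index m ` B" using that(2) assms(2,3) by (auto simp: esd_faces_def)
    then obtain c d where cd: "c \<in> B" "esd_index m c = 0" "d \<in> B" "esd_index m d = m"
      by (metis imageE)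
    have "m - i < c \<and> c < m + 1 + i" "d < m - i \<or> m + 1 + i < d"
      using cd assms(2,3) by (auto simp: esd_index_def split: if_splits)
    with cd show ?thesis by blast
  qed
qed (use assms(3) ext in auto)

lemma last_horn_extension:
  assumes "simplicial_set X" "quasi_category (esd X)" "0 < i" "Suc i < n"
  shows "has_extensions X (two_segal_horn n i n) n"
proof -
  define m where "m = n - 1"
  have n: "n = Suc m" using assms(4) by (simp add: m_def)
  have ext: "has_extensions X (subcomplex (2 * m + 1) (esd_faces m ({..m} - {m - i}))) (2 * m + 1)"
    using assms n unfolding quasi_category_def horn_def
    by (intro has_extensions_esd_faces) auto
  \<comment> \<open>The first copy of \<open>[m]\<close> is kept, and the last vertex
    \<open>n = m + 1\<close> goes to \<open>2 * m + 1 - i\<close>, the other vertex of index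
    \<open>m - i\<close>. As \<open>r\<close> collapses the second copy to \<open>n\<close>,
    omitting an index \<open>k\<close> other than \<open>m - i\<close> matches omitting the vertex
    \<open>m - k\<close>.\<close>
  define s where "s = (\<lambda>k\<in>{..n}. if k < n then k else 2 * m + 1 - i)"
  define r where "r = (\<lambda>k\<in>{..2 * m + 1}. min k n)"
  show ?thesis
    unfolding two_segal_horn_def face_union_eq_subcomplex
  proof (rule has_extensions_retract[OF ext, where s = s and r = r])
    show "s \<in> ord_maps n (2 * m + 1)" by (rule ord_mapsI) (use assms n in \<open>auto simp: s_def\<close>)
    show "r \<in> ord_maps (2 * m + 1) n" by (rule ord_mapsI) (auto simp: r_def)
    show "r (s k) = k" if "k \<le> n" for k using that assms n by (auto simp: r_def s_def)
  next
    fix S assume S: "S \<subseteq> {..n}" "S \<in> {S. \<not> {..n} - {i, n} \<subseteq> S}"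
    then obtain l where l: "l \<in> {..n} - {i, n}" "l \<notin> S" by blast
    then have l: "l \<le> m" "l \<noteq> i" "l \<notin> S" using n by auto
    have "esd_index m (s x) \<noteq> m - l" if "x \<in> S" for x
    proof -
      have "x \<noteq> l" "x \<le> n" using that S(1) l(3) by auto
      then show ?thesis using l assms(4) by (auto simp: esd_index_def s_def n split: if_splits)
    qed
    then have "m - l \<notin> esd_index m ` s ` S" by fastforce
    moreover have "m - l \<in> {..m} - {m - i}" using l assms(4) n by auto
    ultimately show "s ` S \<in> esd_faces m ({..m} - {m - i})" unfolding esd_faces_def by blast
  next
    fix S assume S: "S \<subseteq> {..2 * m + 1}" "S \<in> esd_faces m ({..m} - {m - i})"
    then obtain k where k: "k \<le> m" "k \<noteq> m - i" "k \<notin> esd_index m ` S" by (auto simp: esd_faces_def)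
    have "r x \<noteq> m - k" if "x \<in> S" for x
    proof
      assume "r x = m - k"
      then have "k = esd_index m x"
        using that S(1) k(1) by (auto simp: r_def n esd_index_def min_def split: if_splits)
      then show False using k(3) that by blast
    qed
    moreover have "m - k \<in> {..n} - {i, n}" using k n by auto
    ultimately show "r ` S \<in> {S. \<not> {..n} - {i, n} \<subseteq> S}" by fastforce
  qed
qed

lemma first_horn_extension:
  assumes "simplicial_set X" "quasi_category (esd X)" "Suc 0 < j" "j < n"
  shows "has_extensions X (two_segal_horn n 0 j) n"
proof -
  define m where "m = n - 1"
  have n: "n = Suc m" using assms(4) by (simp add: m_def)
  have ext: "has_extensions X (subcomplex (2 * m + 1) (esd_faces m ({..m} - {j - 1}))) (2 * m + 1)"
    using assms n unfolding quasi_category_def horn_def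
    by (intro has_extensions_esd_faces) auto
  \<comment> \<open>In mirror image, the second copy carries the vertices from \<open>1\<close> to
    \<open>n\<close>, and \<open>0\<close> goes to the partner of \<open>j\<close> in the first
    copy, their common index being \<open>j - 1\<close>. The truncated subtraction in
    \<open>r\<close> collapses the first copy to \<open>0\<close>.\<close>
  define s where "s = (\<lambda>k\<in>{..n}. if k = 0 then m - (j - 1) else k + m)"
  define r where "r = (\<lambda>k\<in>{..2 * m + 1}. k - m)"
  show ?thesis
    unfolding two_segal_horn_def face_union_eq_subcomplex
  proof (rule has_extensions_retract[OF ext, where s = s and r = r])
    show "s \<in> ord_maps n (2 * m + 1)" by (rule ord_mapsI) (use assms n in \<open>auto simp: s_def\<close>)
    show "r \<in> ord_maps (2 * m + 1) n" by (rule ord_mapsI) (auto simp: r_def n)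
    show "r (s k) = k" if "k \<le> n" for k using that assms n by (auto simp: r_def s_def)
  next
    fix S assume S: "S \<subseteq> {..n}" "S \<in> {S. \<not> {..n} - {0, j} \<subseteq> S}"
    then obtain l where l: "0 < l" "l \<le> n" "l \<noteq> j" "l \<notin> S" by auto
    have "esd_index m (s x) \<noteq> l - 1" if "x \<in> S" for x
      using that S(1) l assms(3,4) by (cases x; cases l) (auto simp: esd_index_def s_def n split: if_splits)
    moreover have "l - 1 \<in> {..m} - {j - 1}" using l assms(3) n by auto
    ultimately show "s ` S \<in> esd_faces m ({..m} - {j - 1})" by (fastforce simp: esd_faces_def)
  next
    fix S assume S: "S \<subseteq> {..2 * m + 1}" "S \<in> esd_faces m ({..m} - {j - 1})"
    then obtain k where k: "k \<le> m" "k \<noteq> j - 1" "k \<notin> esd_index m ` S" by (auto simp: esd_faces_def)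
    have "r x \<noteq> Suc k" if "x \<in> S" for x
    proof
      assume "r x = Suc k"
      then have "k = esd_index m x"
        using that S(1) by (auto simp: r_def esd_index_def)
      then show False using k(3) that by blast
    qed
    moreover have "Suc k \<in> {..n} - {0, j}" using k n by auto
    ultimately show "r ` S \<in> {S. \<not> {..n} - {0, j} \<subseteq> S}" by fastforce
  qed
qed

section \<open>The remaining 2-Segal horns, by induction on the smaller vertex\<close>

text \<open>For \<open>0 < i < j < n\<close> the horn is first extended over a simplex \<open>g1\<close> that may have the wrong face
  opposite \<open>0\<close>. The wrong and the right face agree on their faces opposite the vertices other than
  \<open>i\<close> and \<open>j\<close>; \<open>g2\<close> is a homotopy between them, parallel to a doubled last vertex, and \<open>g3\<close> transports
  \<open>g1\<close> along it.\<close>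

lemma two_segal_horn_extension:
  assumes X: "simplicial_set X" and qc: "quasi_category (esd X)"
  shows "i < j \<Longrightarrow> broken n {i, j} \<Longrightarrow> has_extensions X (two_segal_horn n i j) n"
proof (induction i arbitrary: j)
  case 0
  then show ?case using first_horn_extension[OF X qc, of j n] broken_pair[OF 0(1)] by auto
next
  case (Suc i j)
  have ij: "Suc (Suc i) < j" "j \<le> n" using Suc.prems broken_pair by auto
  define a where "a = Suc i"
  show ?case
  proof (cases "j = n")
    case True
    then show ?thesis using last_horn_extension[OF X qc, of "Suc i" n] ij by auto
  next
    case False
    then have jn: "j < n" "0 < n" using ij by auto
    let ?T = "{..n} - {a, j}" let ?T' = "{..n} - {0, a, j}"
    have T: "0 \<in> ?T" "n \<in> ?T'" using jn ij by (auto simp: a_def)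
    show ?thesis
      unfolding two_segal_horn_def face_union_eq_subcomplex has_extensions_def a_def[symmetric]
    proof (intro allI impI)
      fix f assume f: "simplicial_map (subcomplex n {S. \<not> ?T \<subseteq> S}) X f"
      \<comment> \<open>Every missing set contains \<open>Suc a\<close> and \<open>n\<close>, so the
        pair \<open>{0, j}\<close> works, whether or not \<open>a\<close> is present, and only horns
        at \<open>{0, j'}\<close> are filled.\<close>
      have ext1: "has_extensions X (subcomplex n {S. \<not> ?T' \<subseteq> S}) n"
      proof (rule has_extensions_by_pair[of 0 j])
        fix B assume "B \<subseteq> {..n}" "B \<notin> {S. \<not> ?T' \<subseteq> S}"
        moreover have "Suc a \<in> ?T'" using ij by (auto simp: a_def)
        ultimately have "Suc a \<in> B" "n \<in> B" using T by auto
        then show "(\<exists>c\<in>B. 0 < c \<and> c < j) \<and> (\<exists>d\<in>B. d < 0 \<or> j < d)"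
          using ij jn by (intro conjI bexI[of _ "Suc a"] bexI[of _ n]) (auto simp: a_def)
      next
        fix n' i' j' :: nat assume "i' < j'" "broken n' {i', j'}" "(0::nat) = 0 \<Longrightarrow> i' = 0"
        then show "has_extensions X (two_segal_horn n' i' j') n'"
          using first_horn_extension[OF X qc, of j' n'] broken_pair[of i' j' n'] by auto
      next
        show "down_closed {S. \<not> ?T' \<subseteq> S}" unfolding down_closed_def by blast
      qed (use ij in auto)
      have "simplicial_map (subcomplex n {S. \<not> ?T' \<subseteq> S}) X f"
        by (rule simplicial_map_restrict[OF f]) auto
      with ext1 obtain g1 where g1: "simplicial_map (subcomplex n UNIV) X g1"
        and g1f: "\<And>m \<sigma>. \<sigma> \<in> ord_maps m n \<Longrightarrow> \<not> ?T' \<subseteq> \<sigma> ` {..m} \<Longrightarrow> g1 m \<sigma> = f m \<sigma>"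
        unfolding has_extensions_def std_simplex_eq_subcomplex by auto

      \<comment> \<open>\<open>\<rho>\<close> runs through the vertices \<open>1\<close> to
        \<open>n\<close> with the last one doubled. In the homotopy, the face opposite
        \<open>n - 1\<close>, which is \<open>?A\<close>, carries the wrong face; the faces in
        \<open>?B\<close> carry \<open>f\<close> along \<open>\<rho>\<close>, and the one opposite
        \<open>n\<close> is the right face.\<close>
      define \<rho> where "\<rho> = (\<lambda>k\<in>{..n}. min (Suc k) n)"
      have \<rho>: "\<rho> \<in> ord_maps n n" by (rule ord_mapsI) (auto simp: \<rho>_def)
      let ?A = "{S. n - 1 \<notin> S}" let ?B = "{S. \<not> {..n} - {i, j - 1, n - 1} \<subseteq> S}"
      \<comment> \<open>An omitted \<open>l\<close> becomes an omitted vertex after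
        \<open>\<rho>\<close>. For \<open>l = n\<close> this uses that \<open>n - 1\<close>, the
        other preimage of \<open>n\<close>, is omitted as well.\<close>
      have \<rho>B: "\<not> ?T' \<subseteq> \<rho> ` S" if S: "S \<subseteq> {..n}" "S \<in> ?A" "S \<in> ?B" for S
      proof -
        obtain l where l: "l \<in> {..n} - {i, j - 1, n - 1}" "l \<notin> S" using S(3) by blast
        have "min (Suc l) n \<noteq> \<rho> x" if "x \<in> S" for x
        proof -
          have "x \<le> n" "x \<noteq> l" "x \<noteq> n - 1" using that S l(2) by auto
          then show ?thesis using l(1) by (auto simp: \<rho>_def min_def)
        qed
        moreover have "min (Suc l) n \<in> ?T'" using l(1) ij jn by (auto simp: a_def min_def)
        ultimately show ?thesis by blast
      qed
      have g1\<rho>: "simplicial_map (subcomplex n ?A) X (\<lambda>m \<sigma>. g1 m (compose {..m} \<rho> \<sigma>))"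
        by (rule simplicial_map_pullback[OF g1 \<rho>]) simp
      have f\<rho>: "simplicial_map (subcomplex n ?B) X (\<lambda>m \<sigma>. f m (compose {..m} \<rho> \<sigma>))"
      proof (rule simplicial_map_pullback[OF f \<rho>])
        fix S assume "S \<subseteq> {..n}"
        then have "0 \<notin> \<rho> ` S" using jn by (auto simp: \<rho>_def)
        then show "\<rho> ` S \<in> {S. \<not> ?T \<subseteq> S}" using T(1) by blast
      qed
      have eq\<rho>: "g1 m (compose {..m} \<rho> \<sigma>) = f m (compose {..m} \<rho> \<sigma>)"
        if "\<sigma> \<in> ord_maps m n" "\<sigma> ` {..m} \<in> ?A" "\<sigma> ` {..m} \<in> ?B" for m \<sigma>
        using \<rho>B[OF image_ord_maps[OF that(1)] that(2,3)]
        by (intro g1f ord_maps_compose[OF that(1) \<rho>]) (simp add: image_compose)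
      obtain h where h: "simplicial_map (subcomplex n (?A \<union> ?B)) X h"
        and hA: "\<And>m \<sigma>. \<sigma> \<in> ord_maps m n \<Longrightarrow> \<sigma> ` {..m} \<in> ?A \<Longrightarrow> h m \<sigma> = g1 m (compose {..m} \<rho> \<sigma>)"
        and hB: "\<And>m \<sigma>. \<sigma> \<in> ord_maps m n \<Longrightarrow> \<sigma> ` {..m} \<in> ?B \<Longrightarrow> h m \<sigma> = f m (compose {..m} \<rho> \<sigma>)"
        by (rule simplicial_map_glue[OF g1\<rho> f\<rho> _ _ eq\<rho>])
          (auto simp only: down_closed_def mem_Collect_eq subset_eq)
      have "n - 1 \<in> {..n} - {i, j - 1}" using ij jn by auto
      then have AB: "?A \<union> ?B = {S. \<not> {..n} - {i, j - 1} \<subseteq> S}" by blast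
      \<comment> \<open>Passing to the face opposite \<open>0\<close> shifts \<open>{a, j}\<close>
        down by one. The gap is unchanged and \<open>n\<close> lies after it, so the pair is still
        broken and the induction hypothesis applies.\<close>
      have "broken n {i, j - 1}" using ij jn by (subst broken_pair) auto
      then have ext2: "has_extensions X (subcomplex n (?A \<union> ?B)) n"
        using Suc.IH[of "j - 1"] ij unfolding AB by (simp add: two_segal_horn_def face_union_eq_subcomplex)
      then obtain g2 where g2: "simplicial_map (subcomplex n UNIV) X g2"
        and g2h: "\<And>m \<sigma>. \<sigma> \<in> ord_maps m n \<Longrightarrow> \<sigma> ` {..m} \<in> ?A \<union> ?B \<Longrightarrow> g2 m \<sigma> = h m \<sigma>"
        using h unfolding has_extensions_def std_simplex_eq_subcomplex subcomplex_simplices by blast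

      \<comment> \<open>\<open>\<pi>\<close> identifies the face opposite \<open>0\<close> of the
        larger simplex with the \<open>n\<close>-simplex, and \<open>\<mu>\<close> is the degeneracy
        doubling the last vertex.\<close>
      define \<pi> where "\<pi> = (\<lambda>k\<in>{..Suc n}. k - 1)"
      define \<mu> where "\<mu> = (\<lambda>k\<in>{..Suc n}. min k n)"
      have \<pi>: "\<pi> \<in> ord_maps (Suc n) n" by (rule ord_mapsI) (auto simp: \<pi>_def)
      have \<mu>: "\<mu> \<in> ord_maps (Suc n) n" by (rule ord_mapsI) (auto simp: \<mu>_def)
      have \<rho>\<pi>: "compose {..m} \<rho> (compose {..m} \<pi> \<sigma>) = compose {..m} \<mu> \<sigma>"
        if "\<sigma> \<in> ord_maps m (Suc n)" "0 \<notin> \<sigma> ` {..m}" for m \<sigma>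
      proof
        fix x
        show "compose {..m} \<rho> (compose {..m} \<pi> \<sigma>) x = compose {..m} \<mu> \<sigma> x"
        proof (cases "x \<le> m")
          case True
          then have "\<sigma> x \<le> Suc n" "\<sigma> x \<noteq> 0" using ord_maps_le[OF that(1)] that(2) by force+
          then show ?thesis using True by (auto simp: compose_def \<rho>_def \<pi>_def \<mu>_def)
        qed (simp add: compose_def)
      qed
      \<comment> \<open>The face opposite \<open>0\<close> carries the homotopy \<open>g2\<close>,
        the face opposite \<open>n\<close> carries \<open>g1\<close>, and the faces in
        \<open>?C3\<close> carry \<open>f\<close> along \<open>\<mu>\<close>. The face opposite
        \<open>Suc n\<close> is left open and becomes the corrected filler.\<close>
      let ?C1 = "{S. 0 \<notin> S}" let ?C2 = "{S. n \<notin> S}" let ?C3 = "{S. \<not> {..n} - {0, a, j, n} \<subseteq> S}"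
      \<comment> \<open>\<open>\<pi>\<close> shifts an omitted \<open>l\<close> to
        \<open>l - 1\<close>. The value \<open>l = n\<close> is excluded because it gives the face
        opposite \<open>n - 1\<close> with the wrong values, while \<open>l = Suc n\<close> gives
        the right face.\<close>
      have \<pi>B: "\<pi> ` S \<in> ?B" if S: "S \<subseteq> {..Suc n}" "0 \<notin> S" and l: "l \<in> ?T - {0, n} \<or> l = Suc n" "l \<notin> S" for S l
      proof -
        have "l - 1 \<noteq> \<pi> x" if "x \<in> S" for x
        proof -
          have "x \<noteq> 0" "x \<noteq> l" "x \<le> Suc n" using that S l(2) by (auto intro: ccontr)
          then show ?thesis using l(1) by (auto simp: \<pi>_def)
        qed
        moreover have "l - 1 \<in> {..n} - {i, j - 1, n - 1}" using l(1) jn ij by (auto simp: a_def)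
        ultimately show ?thesis by blast
      qed
      have g2f: "g2 m (compose {..m} \<pi> \<sigma>) = f m (compose {..m} \<mu> \<sigma>)"
        if \<sigma>: "\<sigma> \<in> ord_maps m (Suc n)" "0 \<notin> \<sigma> ` {..m}" and l: "l \<in> ?T - {0, n} \<or> l = Suc n" "l \<notin> \<sigma> ` {..m}" for m \<sigma> l
      proof -
        have c: "compose {..m} \<pi> \<sigma> \<in> ord_maps m n" by (rule ord_maps_compose[OF \<sigma>(1) \<pi>])
        have B: "compose {..m} \<pi> \<sigma> ` {..m} \<in> ?B"
          unfolding image_compose by (rule \<pi>B[OF image_ord_maps[OF \<sigma>(1)] \<sigma>(2) l])
        then show ?thesis using g2h[OF c] hB[OF c B] \<rho>\<pi>[OF \<sigma>] by simp
      qed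
      have m1: "simplicial_map (subcomplex (Suc n) ?C1) X (\<lambda>m \<sigma>. g2 m (compose {..m} \<pi> \<sigma>))"
        by (rule simplicial_map_pullback[OF g2 \<pi>]) simp
      have m2: "simplicial_map (subcomplex (Suc n) ?C2) X (\<lambda>m \<sigma>. g1 m (compose {..m} \<mu> \<sigma>))"
        by (rule simplicial_map_pullback[OF g1 \<mu>]) simp
      have \<mu>l: "l \<notin> \<mu> ` S" if "S \<subseteq> {..Suc n}" "l < n" "l \<notin> S" for S l
        using that by (auto simp: \<mu>_def min_def)
      have m3: "simplicial_map (subcomplex (Suc n) ?C3) X (\<lambda>m \<sigma>. f m (compose {..m} \<mu> \<sigma>))"
      proof (rule simplicial_map_pullback[OF f \<mu>])
        fix S assume S: "S \<subseteq> {..Suc n}" "S \<in> ?C3"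
        then obtain l where l: "l \<in> {..n} - {0, a, j, n}" "l \<notin> S" by blast
        then have "l \<notin> \<mu> ` S" using \<mu>l[OF S(1)] by auto
        then show "\<mu> ` S \<in> {S. \<not> ?T \<subseteq> S}" using l(1) by blast
      qed
      have eq12: "g2 m (compose {..m} \<pi> \<sigma>) = g1 m (compose {..m} \<mu> \<sigma>)"
        if \<sigma>: "\<sigma> \<in> ord_maps m (Suc n)" "\<sigma> ` {..m} \<in> ?C1" "\<sigma> ` {..m} \<in> ?C2" for m \<sigma>
      proof -
        have c: "compose {..m} \<pi> \<sigma> \<in> ord_maps m n" by (rule ord_maps_compose[OF \<sigma>(1) \<pi>])
        have "n - 1 \<noteq> \<pi> x" if "x \<in> \<sigma> ` {..m}" for x
        proof -
          have "x \<noteq> 0" "x \<noteq> n" "x \<le> Suc n"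
            using that \<sigma>(2,3) image_ord_maps[OF \<sigma>(1)] by (auto intro: ccontr)
          then show ?thesis using jn by (auto simp: \<pi>_def)
        qed
        then have A: "compose {..m} \<pi> \<sigma> ` {..m} \<in> ?A" unfolding image_compose by blast
        have "0 \<notin> \<sigma> ` {..m}" using \<sigma>(2) by simp
        then show ?thesis using A g2h[OF c] hA[OF c A] \<rho>\<pi>[OF \<sigma>(1)] by simp
      qed
      obtain h' where h': "simplicial_map (subcomplex (Suc n) (?C1 \<union> ?C2)) X h'"
        and h'1: "\<And>m \<sigma>. \<sigma> \<in> ord_maps m (Suc n) \<Longrightarrow> \<sigma> ` {..m} \<in> ?C1 \<Longrightarrow> h' m \<sigma> = g2 m (compose {..m} \<pi> \<sigma>)"
        and h'2: "\<And>m \<sigma>. \<sigma> \<in> ord_maps m (Suc n) \<Longrightarrow> \<sigma> ` {..m} \<in> ?C2 \<Longrightarrow> h' m \<sigma> = g1 m (compose {..m} \<mu> \<sigma>)"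
        by (rule simplicial_map_glue[OF m1 m2 _ _ eq12])
          (auto simp only: down_closed_def mem_Collect_eq subset_eq)
      have eq3: "h' m \<sigma> = f m (compose {..m} \<mu> \<sigma>)"
        if \<sigma>: "\<sigma> \<in> ord_maps m (Suc n)" "\<sigma> ` {..m} \<in> ?C1 \<union> ?C2" "\<sigma> ` {..m} \<in> ?C3" for m \<sigma>
      proof -
        obtain l where l: "l \<in> {..n} - {0, a, j, n}" "l \<notin> \<sigma> ` {..m}" using \<sigma>(3) by blast
        show ?thesis
        proof (cases "0 \<in> \<sigma> ` {..m}")
          case True
          then have C2: "\<sigma> ` {..m} \<in> ?C2" using \<sigma>(2) by simp
          have "l \<notin> \<mu> ` \<sigma> ` {..m}" using \<mu>l[OF image_ord_maps[OF \<sigma>(1)] _ l(2)] l(1) by simp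
          then have "\<not> ?T' \<subseteq> compose {..m} \<mu> \<sigma> ` {..m}" unfolding image_compose using l(1) by blast
          then show ?thesis using h'2[OF \<sigma>(1) C2] g1f[OF ord_maps_compose[OF \<sigma>(1) \<mu>]] by simp
        next
          case False
          then have C1: "\<sigma> ` {..m} \<in> ?C1" by simp
          show ?thesis using h'1[OF \<sigma>(1) C1] g2f[OF \<sigma>(1) False _ l(2)] l(1) by simp
        qed
      qed
      obtain u where u: "simplicial_map (subcomplex (Suc n) (?C1 \<union> ?C2 \<union> ?C3)) X u"
        and u12: "\<And>m \<sigma>. \<sigma> \<in> ord_maps m (Suc n) \<Longrightarrow> \<sigma> ` {..m} \<in> ?C1 \<union> ?C2 \<Longrightarrow> u m \<sigma> = h' m \<sigma>"
        and u3: "\<And>m \<sigma>. \<sigma> \<in> ord_maps m (Suc n) \<Longrightarrow> \<sigma> ` {..m} \<in> ?C3 \<Longrightarrow> u m \<sigma> = f m (compose {..m} \<mu> \<sigma>)"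
        by (rule simplicial_map_glue[OF h' m3 _ _ eq3])
          (auto simp only: down_closed_def mem_Collect_eq subset_eq Un_iff)
      have C: "?C1 \<union> ?C2 \<union> ?C3 = {S. \<not> ?T \<subseteq> S}" using T by blast
      \<comment> \<open>Missing sets contain \<open>0\<close> and \<open>Suc a\<close>, on the two
        sides of the pair \<open>{a, Suc n}\<close>. As this pair contains the last vertex, only
        horns at \<open>{i', n'}\<close> are filled.\<close>
      have ext3: "has_extensions X (subcomplex (Suc n) {S. \<not> ?T \<subseteq> S}) (Suc n)"
      proof (rule has_extensions_by_pair[of a "Suc n"])
        fix B assume "B \<subseteq> {..Suc n}" "B \<notin> {S. \<not> ?T \<subseteq> S}"
        moreover have "Suc a \<in> ?T" using ij by (auto simp: a_def)
        ultimately have "Suc a \<in> B" "0 \<in> B" using T by auto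
        then show "(\<exists>c\<in>B. a < c \<and> c < Suc n) \<and> (\<exists>d\<in>B. d < a \<or> Suc n < d)"
          using ij jn by (intro conjI bexI[of _ "Suc a"] bexI[of _ 0]) (auto simp: a_def)
      next
        fix n' i' j' :: nat assume "i' < j'" "broken n' {i', j'}" "Suc n = Suc n \<Longrightarrow> j' = n'"
        then show "has_extensions X (two_segal_horn n' i' j') n'"
          using last_horn_extension[OF X qc, of i' n'] broken_pair[of i' j' n'] by auto
      next
        show "down_closed {S. \<not> ?T \<subseteq> S}" unfolding down_closed_def by blast
        show "insert a (insert (Suc n) S) \<in> {S. \<not> ?T \<subseteq> S}" if "S \<in> {S. \<not> ?T \<subseteq> S}" for S
          using that by auto
      qed (use ij jn in \<open>auto simp: a_def\<close>)
      then obtain g3 where g3: "simplicial_map (subcomplex (Suc n) UNIV) X g3"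
        and g3u: "\<And>m \<sigma>. \<sigma> \<in> ord_maps m (Suc n) \<Longrightarrow> \<sigma> ` {..m} \<in> ?C1 \<union> ?C2 \<union> ?C3 \<Longrightarrow> g3 m \<sigma> = u m \<sigma>"
        using u unfolding has_extensions_def std_simplex_eq_subcomplex subcomplex_simplices C by blast

      define \<iota> where "\<iota> = (\<lambda>k\<in>{..n}. k)"
      have \<iota>: "\<iota> \<in> ord_maps n (Suc n)" by (rule ord_mapsI) (auto simp: \<iota>_def)
      have "simplicial_map (subcomplex n UNIV) X (\<lambda>m \<sigma>. g3 m (compose {..m} \<iota> \<sigma>))"
        by (rule simplicial_map_pullback[OF g3 \<iota>]) simp
      moreover have "g3 m (compose {..m} \<iota> \<sigma>) = f m \<sigma>"
        if "\<sigma> \<in> simplices (subcomplex n {S. \<not> ?T \<subseteq> S}) m" for m \<sigma>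
      proof -
        from that obtain l where \<sigma>: "\<sigma> \<in> ord_maps m n" and l: "l \<in> ?T" "l \<notin> \<sigma> ` {..m}" by auto
        have le: "x \<le> n" if "x \<in> \<sigma> ` {..m}" for x using that image_ord_maps[OF \<sigma>] by auto
        have \<iota>\<sigma>: "compose {..m} \<iota> \<sigma> = \<sigma>" using le by (intro compose_eq_self[OF \<sigma>]) (simp add: \<iota>_def)
        have \<mu>\<sigma>: "compose {..m} \<mu> \<sigma> = \<sigma>" using le by (intro compose_eq_self[OF \<sigma>]) (simp add: \<mu>_def le_SucI)
        have \<sigma>': "\<sigma> \<in> ord_maps m (Suc n)" using ord_maps_compose[OF \<sigma> \<iota>] \<iota>\<sigma> by simp
        have K: "\<sigma> ` {..m} \<in> ?C1 \<union> ?C2 \<union> ?C3" unfolding C using l by blast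
        \<comment> \<open>On the face opposite \<open>n\<close> the simplex \<open>g1\<close> is
          already correct. On the face opposite \<open>0\<close>, \<open>\<sigma>\<close> also omits
          \<open>Suc n\<close>, so \<open>g2\<close> takes its right values. The other faces carry
          \<open>f\<close> by construction.\<close>
        consider "l = n" | "l = 0" | "l \<in> {..n} - {0, a, j, n}" using l(1) by blast
        then have "u m \<sigma> = f m \<sigma>"
        proof cases
          case 1
          then have C2: "\<sigma> ` {..m} \<in> ?C2" using l(2) by simp
          have "\<not> ?T' \<subseteq> \<sigma> ` {..m}" using l(2) T(2) 1 by blast
          then show ?thesis using u12[OF \<sigma>'] h'2[OF \<sigma>' C2] C2 g1f[OF \<sigma>] by (simp add: \<mu>\<sigma>)
        next
          case 2
          then have C1: "\<sigma> ` {..m} \<in> ?C1" using l(2) by simp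
          have "0 \<notin> \<sigma> ` {..m}" "Suc n \<notin> \<sigma> ` {..m}" using l(2) 2 le by fastforce+
          then have "g2 m (compose {..m} \<pi> \<sigma>) = f m \<sigma>" using g2f[OF \<sigma>'] \<mu>\<sigma> by metis
          then show ?thesis using u12[OF \<sigma>'] h'1[OF \<sigma>' C1] C1 by simp
        next
          case 3
          then have "\<sigma> ` {..m} \<in> ?C3" using l(2) by blast
          then show ?thesis using u3[OF \<sigma>'] \<mu>\<sigma> by simp
        qed
        then show ?thesis using g3u[OF \<sigma>' K] \<iota>\<sigma> by simp
      qed
      ultimately show "\<exists>g. simplicial_map (std_simplex n) X g \<and>
          (\<forall>m. \<forall>\<sigma>\<in>simplices (subcomplex n {S. \<not> ?T \<subseteq> S}) m. g m \<sigma> = f m \<sigma>)"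
        unfolding std_simplex_eq_subcomplex by blast
    qed
  qed
qed

theorem proposition6p7:
  fixes X :: "'a sset"
  assumes "simplicial_set X"
  shows "quasi_2_segal_set X \<longleftrightarrow> quasi_category (esd X)"
proof
  assume q: "quasi_2_segal_set X"
  have "has_extensions X (two_segal_horn n i j) n" if "i < j" "broken n {i, j}" for n i j
  proof -
    have "3 \<le> n" using that broken_pair[OF that(1), of n] by auto
    then show ?thesis using q that unfolding quasi_2_segal_set_def by auto
  qed
  then show "quasi_category (esd X)"
    unfolding quasi_category_def
    using simplicial_set_esd[OF assms] esd_horn_extension[OF assms] by blast
next
  assume q: "quasi_category (esd X)"
  have "has_extensions X (two_segal_horn n i j) n" if "i \<noteq> j" "broken n {i, j}" for n i j
  proof (cases "i < j")
    case True
    then show ?thesis using two_segal_horn_extension[OF assms q] that(2) by blast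
  next
    case False
    then have "has_extensions X (two_segal_horn n j i) n"
      using two_segal_horn_extension[OF assms q, of j i n] that by (auto simp: insert_commute)
    then show ?thesis by (simp add: two_segal_horn_def insert_commute)
  qed
  then show "quasi_2_segal_set X"
    unfolding quasi_2_segal_set_def using assms by blast
qed

end
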